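(* Let $(X,d_X)$ and $(Y,d_Y)$ be compact metric spaces, let $\mu\in\mathcal{P}(X)$ and $\nu\in\mathcal{P}(Y)$ with $\operatorname{supp}(\mu)=X$ and $\operatorname{supp}(\nu)=Y$, let $c:X\times Y\to\mathbb{R}$ be Lipschitz continuous, and put $A=-c$. Then the following hold. 1. For every $\beta>0$ there is a pair of functions $\varphi_\beta\in C(X)$, $\psi_\beta\in C(Y)$ such that $$\int_X e^{\beta A(x,y)+\varphi_\beta(x)+\psi_\beta(y)}\,d\mu(x)=1\quad\forall y\in Y\qquad\text{and}\qquad \int_Y e^{\beta A(x,y)+\varphi_\beta(x)+\psi_\beta(y)}\,d\nu(y)=1\quad\forall x\in X.$$ The pair is unique in the following sense: if $(\tilde\varphi_\beta,\tilde\psi_\beta)\in C(X)\times C(Y)$ is another pair satisfying the same two identities, then there is a constant $d_\beta\in\mathbb{R}$ such that $\tilde\varphi_\beta=\varphi_\beta+d_\beta$ and $\tilde\psi_\beta=\psi_\beta-d_\beta$. Furthermore, these functions are Lipschitz continuous and satisfy $\operatorname{Lip}(\varphi_\beta)\le\beta\operatorname{Lip}(A)$ and $\operatorname{Lip}(\psi_\beta)\le\beta\operatorname{Lip}(A)$. 2. For every $\beta>0$ and every pair $(\varphi_\beta,\psi_\beta)$ as in item 1, the measure $d\pi_\beta:=e^{\beta A+\varphi_\beta+\psi_\beta}\,d\mu\,d\nu$ is a probability on $X\times Y$ belonging to $\Pi(\mu,\nu)$. Furthermore, $$P(\beta A)=\int \beta A\,d\pi_\beta+H(\pi_\beta)=-\int\varphi_\beta\,d\mu-\int\psi_\beta\,d\nu.$$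 3. The families $\left(\frac{\varphi_\beta}{\beta}\right)_{\beta>0}$ and $\left(\frac{\psi_\beta}{\beta}\right)_{\beta>0}$ are equicontinuous, and the pairs $(\varphi_\beta,\psi_\beta)$ of item 1 can be chosen so that both families are uniformly bounded. If $\beta_n\to+\infty$ and $\left(\frac{\varphi_{\beta_n}}{\beta_n},\frac{\psi_{\beta_n}}{\beta_n}\right)$ converges uniformly to $(\varphi,\psi)$, then $(\varphi,\psi)$ is a solution of the Kantorovich dual problem, that is, $(\varphi,\psi)\in\Phi_c$ and $\alpha(c)=\int\varphi\,d\mu+\int\psi\,d\nu$. If $\beta_n\to+\infty$ and $\pi_{\beta_n}\to\pi$ in the weak* topology, then $\pi$ is a solution of the Monge-Kantorovich problem, that is, $\pi\in\Pi(\mu,\nu)$ and $\int c\,d\pi=\alpha(c)$.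
   Context: $\mathcal{P}(Z)$ denotes the set of Borel probabilities on a compact metric space $Z$, and $C(Z)$ the continuous real functions on $Z$. The product $X\times Y$ carries the metric $d_X+d_Y$. $\operatorname{Lip}(f)$ denotes the (best) Lipschitz constant of $f$. $\Pi(\mu,\nu)$ is the set of transference plans: the $\pi\in\mathcal{P}(X\times Y)$ with $x$-marginal $\mu$ and $y$-marginal $\nu$. $\alpha(c)=\min_{\pi\in\Pi(\mu,\nu)}\int c\,d\pi$, and $\Phi_c=\{(\varphi,\psi)\in C(X)\times C(Y)\,:\,\varphi(x)+\psi(y)\le c(x,y)\ \forall x\in X,\,y\in Y\}$. For probabilities $\eta,\rho$ on the same measurable space, the Kullback-Leibler divergence is $D_{KL}(\eta|\rho)=\int\log\left(\frac{d\eta}{d\rho}\right)d\eta$ if $\eta\ll\rho$, and $+\infty$ otherwise. For $\pi\in\Pi(\mu,\nu)$ the entropy is $H(\pi)=-D_{KL}(\pi\,|\,\mu\times\nu)\in[-\infty,0]$. For continuous $B:X\times Y\to\mathbb{R}$ the pressure is $P(B)=\sup_{\pi\in\Pi(\mu,\nu)}\left[\int B\,d\pi+H(\pi)\right]$. *)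

theory Defs
  imports "HOL-Probability.Probability"
begin

text \<open>
  A compact metric space is a type \<open>'a :: metric_space\<close> with \<open>compact (UNIV :: 'a set)\<close>.
  The topology of the type \<open>'a \<times> 'b\<close> is the product topology, but its \<^const>\<open>dist\<close> is
  Euclidean.  Lipschitz constants on products are taken with respect to the sum metric
  \<open>sum_dist\<close>, hence the explicit distance argument below.
\<close>

definition sum_dist :: "'a::metric_space \<times> 'b::metric_space \<Rightarrow> 'a \<times> 'b \<Rightarrow> real" where
  "sum_dist p q = dist (fst p) (fst q) + dist (snd p) (snd q)"

definition lipschitz_wrt :: "('z \<Rightarrow> 'z \<Rightarrow> real) \<Rightarrow> real \<Rightarrow> ('z \<Rightarrow> real) \<Rightarrow> bool" where
  "lipschitz_wrt d L f \<longleftrightarrow> 0 \<le> L \<and> (\<forall>z w. \<bar>f z - f w\<bar> \<le> L * d z w)"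

lemma lipschitz_wrt_dist: "lipschitz_wrt dist L f \<longleftrightarrow> L-lipschitz_on UNIV f"
  by (auto simp: lipschitz_wrt_def lipschitz_on_def dist_real_def)

definition lipschitz_cont :: "('z \<Rightarrow> 'z \<Rightarrow> real) \<Rightarrow> ('z \<Rightarrow> real) \<Rightarrow> bool" where
  "lipschitz_cont d f \<longleftrightarrow> (\<exists>L. lipschitz_wrt d L f)"

text \<open>Only meaningful for Lipschitz continuous \<open>f\<close>.\<close>

definition Lip :: "('z \<Rightarrow> 'z \<Rightarrow> real) \<Rightarrow> ('z \<Rightarrow> real) \<Rightarrow> real" where
  "Lip d f = Inf {L. lipschitz_wrt d L f}"

text \<open>The index set carries the whole family; the modulus \<open>\<delta>\<close> is uniform in the point as well as
  in the index (on a compact space this agrees with pointwise equicontinuity).\<close>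

definition equicontinuous_family :: "'i set \<Rightarrow> ('i \<Rightarrow> 'a::metric_space \<Rightarrow> real) \<Rightarrow> bool" where
  "equicontinuous_family I F \<longleftrightarrow>
     (\<forall>\<epsilon>>0. \<exists>\<delta>>0. \<forall>i\<in>I. \<forall>x y. dist x y < \<delta> \<longrightarrow> \<bar>F i x - F i y\<bar> < \<epsilon>)"

definition uniformly_bounded_family :: "'i set \<Rightarrow> ('i \<Rightarrow> 'a \<Rightarrow> real) \<Rightarrow> bool" where
  "uniformly_bounded_family I F \<longleftrightarrow> (\<exists>M. \<forall>i\<in>I. \<forall>x. \<bar>F i x\<bar> \<le> M)"

definition borel_probs :: "'a::topological_space measure set" where
  "borel_probs = {\<mu>. prob_space \<mu> \<and> sets \<mu> = sets borel}"

definition msupport :: "'a::topological_space measure \<Rightarrow> 'a set" where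
  "msupport \<mu> = {x. \<forall>U. open U \<and> x \<in> U \<longrightarrow> emeasure \<mu> U > 0}"

definition weakstar_conv ::
    "(nat \<Rightarrow> 'a::topological_space measure) \<Rightarrow> 'a measure \<Rightarrow> bool" where
  "weakstar_conv \<pi>s \<pi> \<longleftrightarrow>
     (\<forall>f :: 'a \<Rightarrow> real. continuous_on UNIV f \<longrightarrow>
        (\<lambda>n. \<integral>z. f z \<partial>\<pi>s n) \<longlonglongrightarrow> (\<integral>z. f z \<partial>\<pi>))"

definition transference_plans ::
    "'a::topological_space measure \<Rightarrow> 'b::topological_space measure \<Rightarrow> ('a \<times> 'b) measure set" where
  "transference_plans \<mu> \<nu> =
     {\<pi> \<in> borel_probs. distr \<pi> borel fst = \<mu> \<and> distr \<pi> borel snd = \<nu>}"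

text \<open>The minimum over all plans is written as an infimum; by compactness of the set of plans
  the two agree for continuous \<open>c\<close>.\<close>

definition transport_cost ::
    "'a::topological_space measure \<Rightarrow> 'b::topological_space measure \<Rightarrow> ('a \<times> 'b \<Rightarrow> real) \<Rightarrow> real" where
  "transport_cost \<mu> \<nu> c = (INF \<pi>\<in>transference_plans \<mu> \<nu>. \<integral>z. c z \<partial>\<pi>)"

definition dual_feasible ::
    "('a::topological_space \<times> 'b::topological_space \<Rightarrow> real) \<Rightarrow> (('a \<Rightarrow> real) \<times> ('b \<Rightarrow> real)) set" where
  "dual_feasible c = {(\<phi>, \<psi>). continuous_on UNIV \<phi> \<and> continuous_on UNIV \<psi> \<and>
     (\<forall>x y. \<phi> x + \<psi> y \<le> c (x, y))}"

text \<open>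
  The integral of \<open>log (d\<eta>/d\<rho>)\<close> with respect to \<open>\<eta>\<close> is taken in the extended sense, as the
  integral of the positive part minus that of the negative part (\<^const>\<open>ennreal\<close> sends negative
  reals to 0): it can be \<open>\<infinity>\<close>, where the Bochner integral, and hence the library's
  \<^const>\<open>KL_divergence\<close>, would return 0.  The integral of the negative part is always finite
  for probabilities, so \<open>\<infinity> - \<infinity>\<close> does not occur.
\<close>

definition D_KL :: "'a measure \<Rightarrow> 'a measure \<Rightarrow> ereal" where
  "D_KL \<eta> \<rho> =
     (if absolutely_continuous \<rho> \<eta> then
        enn2ereal (\<integral>\<^sup>+z. ennreal (ln (enn2real (RN_deriv \<rho> \<eta> z))) \<partial>\<eta>)
        - enn2ereal (\<integral>\<^sup>+z. ennreal (- ln (enn2real (RN_deriv \<rho> \<eta> z))) \<partial>\<eta>)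
      else \<infinity>)"

definition plan_entropy ::
    "'a measure \<Rightarrow> 'b measure \<Rightarrow> ('a \<times> 'b) measure \<Rightarrow> ereal" where
  "plan_entropy \<mu> \<nu> \<pi> = - D_KL \<pi> (\<mu> \<Otimes>\<^sub>M \<nu>)"

definition pressure ::
    "'a::topological_space measure \<Rightarrow> 'b::topological_space measure \<Rightarrow> ('a \<times> 'b \<Rightarrow> real) \<Rightarrow> ereal" where
  "pressure \<mu> \<nu> B =
     (SUP \<pi>\<in>transference_plans \<mu> \<nu>. ereal (\<integral>z. B z \<partial>\<pi>) + plan_entropy \<mu> \<nu> \<pi>)"

definition normalizing_pair ::
    "'a::topological_space measure \<Rightarrow> 'b::topological_space measure \<Rightarrow> ('a \<times> 'b \<Rightarrow> real) \<Rightarrow> real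
     \<Rightarrow> ('a \<Rightarrow> real) \<Rightarrow> ('b \<Rightarrow> real) \<Rightarrow> bool" where
  "normalizing_pair \<mu> \<nu> A \<beta> \<phi> \<psi> \<longleftrightarrow>
     continuous_on UNIV \<phi> \<and> continuous_on UNIV \<psi> \<and>
     (\<forall>y. (\<integral>x. exp (\<beta> * A (x, y) + \<phi> x + \<psi> y) \<partial>\<mu>) = 1) \<and>
     (\<forall>x. (\<integral>y. exp (\<beta> * A (x, y) + \<phi> x + \<psi> y) \<partial>\<nu>) = 1)"

definition gibbs_plan ::
    "'a measure \<Rightarrow> 'b measure \<Rightarrow> ('a \<times> 'b \<Rightarrow> real) \<Rightarrow> real \<Rightarrow> ('a \<Rightarrow> real) \<Rightarrow> ('b \<Rightarrow> real)
     \<Rightarrow> ('a \<times> 'b) measure" where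
  "gibbs_plan \<mu> \<nu> A \<beta> \<phi> \<psi> =
     density (\<mu> \<Otimes>\<^sub>M \<nu>) (\<lambda>(x, y). ennreal (exp (\<beta> * A (x, y) + \<phi> x + \<psi> y)))"

end

theory Submission
  imports Defs
begin

text \<open>
  Writing \<open>F\<^sub>M f = ln \<integral> exp f dM\<close>, the two normalizing identities say exactly that
  \<open>\<psi> y = - F\<^sub>\<mu> (\<beta> A (-, y) + \<phi>)\<close> and \<open>\<phi> x = - F\<^sub>\<nu> (\<beta> A (x, -) + \<psi>)\<close>.  So \<open>\<phi>\<close> is a fixed point of the
  composition of these two soft transforms, the Sinkhorn map.  Each transform reproduces the
  Lipschitz constant \<open>\<beta> L\<close> of \<open>\<beta> A\<close>, whatever continuous function it is applied to; this gives the
  Lipschitz estimates.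

  Existence and uniqueness come from a Birkhoff-Doeblin contraction.  If
  \<open>exp (osc (\<phi> - \<phi>')) \<le> 1 + E\<close>, then the transforms of \<open>\<phi>\<close> and \<open>\<phi>'\<close> satisfy the same bound with \<open>E\<close>
  replaced by \<open>q E\<close>, where \<open>q < 1\<close> depends only on the oscillation of \<open>\<beta> A\<close>
  (\<open>log_partition_contraction\<close>).  Two solutions therefore differ by a constant, and the Sinkhorn
  iterates, normalized to vanish at one point, converge uniformly.  Their limit is a fixed point up
  to an additive constant, and Fubini forces this constant to be \<open>0\<close>.

  The normalizing identities are the statement that the Gibbs plan has marginals \<open>\<mu>\<close> and \<open>\<nu>\<close>.  For an
  exponent \<open>g\<close> with \<open>\<integral> exp g d\<rho> \<le> 1\<close> the inequality \<open>ln t \<le> t - 1\<close> gives \<open>\<integral> g d\<eta> \<le> D_KL \<eta> \<rho>\<close>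
  (\<open>D_KL_ge_integral\<close>), with equality for \<open>\<eta> = exp g d\<rho>\<close>.  With \<open>g = \<beta> A + \<phi> + \<psi>\<close>, whose integral
  against a plan splits into the energy and the two marginal integrals, this is the variational
  formula for the pressure.

  At low temperature, \<open>v = A + \<phi> / \<beta> + \<psi> / \<beta>\<close> is Lipschitz uniformly in \<open>\<beta>\<close> and
  \<open>\<integral> exp (\<beta> v (-, y)) d\<mu> = 1\<close>.  Since \<open>\<mu>\<close> has full support, balls of a given radius have mass
  bounded below, so \<open>v\<close> cannot exceed \<open>\<epsilon>\<close> once \<open>\<beta>\<close> is large (\<open>approximate_feasibility\<close>): the scaled
  potentials are feasible for the Kantorovich dual up to \<open>\<epsilon>\<close>.  With nonnegativity of the relative
  entropy,
  \<open>\<alpha>(c) \<le> \<integral> c d\<pi>\<^sub>\<beta> \<le> \<integral> \<phi> / \<beta> d\<mu> + \<integral> \<psi> / \<beta> d\<nu> \<le> \<alpha>(c) + \<epsilon>\<close>.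
  Hence both the cost of the Gibbs plans and the value of the scaled potentials tend to \<open>\<alpha>(c)\<close>
  along the whole family, without passing to subsequences, and limits of either kind are optimal.
\<close>

section \<open>Borel probabilities on compact metric spaces\<close>

text \<open>
  The balls in finite covers by balls of radius \<open>1 / (n + 1)\<close>, for all \<open>n\<close>, form a countable base.
  It is needed to identify the Borel sets of a product with the product \<open>\<sigma>\<close>-algebra.
\<close>

lemma compact_metric_countable_base:
  assumes "compact (UNIV :: 'a::metric_space set)"
  obtains \<B> :: "'a::metric_space set set" where "countable \<B>" "\<And>B. B \<in> \<B> \<Longrightarrow> open B"
    "\<And>U x. open U \<Longrightarrow> x \<in> U \<Longrightarrow> \<exists>B\<in>\<B>. x \<in> B \<and> B \<subseteq> U"
proof -
  have "\<exists>D. finite D \<and> (UNIV :: 'a set) \<subseteq> (\<Union>x\<in>D. ball x (inverse (real (Suc n))))" for n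
    by (rule compactE_image[OF assms, of UNIV "\<lambda>x. ball x (inverse (real (Suc n)))"]) auto
  then obtain D where D: "\<And>n. finite (D n)"
    "\<And>n. (UNIV :: 'a set) \<subseteq> (\<Union>x\<in>D n. ball x (inverse (real (Suc n))))"
    by metis
  define \<B> where "\<B> = (\<Union>n. (\<lambda>x. ball x (inverse (real (Suc n)))) ` D n)"
  show ?thesis
  proof (rule that[of \<B>])
    show "countable \<B>"
      unfolding \<B>_def using D(1) by (auto intro: countable_finite)
    show "open B" if "B \<in> \<B>" for B
      using that by (auto simp: \<B>_def)
    fix U and x :: 'a assume "open U" "x \<in> U"
    then obtain e where e: "e > 0" "ball x e \<subseteq> U"
      using open_contains_ball by blast
    obtain n where n: "inverse (real (Suc n)) < e / 2"
      using e(1) reals_Archimedean[of "e / 2"] by auto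
    obtain d where d: "d \<in> D n" "dist d x < inverse (real (Suc n))"
      using subsetD[OF D(2)[of n], of x] by (auto simp del: of_nat_Suc)
    have "ball d (inverse (real (Suc n))) \<subseteq> ball x e"
    proof
      fix z assume "z \<in> ball d (inverse (real (Suc n)))"
      then have "dist d z < e / 2" "dist d x < e / 2"
        using n d(2) by auto
      then show "z \<in> ball x e"
        using dist_triangle[of x z d] by (simp add: dist_commute)
    qed
    with d e(2) show "\<exists>B\<in>\<B>. x \<in> B \<and> B \<subseteq> U"
      unfolding \<B>_def by (intro bexI[of _ "ball d (inverse (real (Suc n)))"]) auto
  qed
qed

text \<open>
  A countable base of one factor suffices: an open \<open>S\<close> is the union, over basic sets \<open>B\<close>, of \<open>B\<close> times
  the largest open set \<open>V\<close> with \<open>B \<times> V \<subseteq> S\<close>.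
\<close>

lemma sets_borel_prod_compact:
  assumes "compact (UNIV :: 'a::metric_space set)"
  shows "sets (borel \<Otimes>\<^sub>M borel) = sets (borel :: ('a \<times> 'b::metric_space) measure)"
proof
  have fst: "fst \<in> measurable (borel :: ('a \<times> 'b) measure) borel"
    and snd: "snd \<in> measurable (borel :: ('a \<times> 'b) measure) borel"
    by (auto intro!: borel_measurable_continuous_onI continuous_intros)
  have "(\<lambda>p. (fst p, snd p)) \<in> measurable (borel :: ('a \<times> 'b) measure) (borel \<Otimes>\<^sub>M borel)"
    by (rule measurable_Pair[OF fst snd])
  from measurable_sets[OF this]
  show "sets (borel \<Otimes>\<^sub>M borel) \<subseteq> sets (borel :: ('a \<times> 'b) measure)"
    by auto
  obtain \<B> :: "'a set set" where \<B>: "countable \<B>" "\<And>B. B \<in> \<B> \<Longrightarrow> open B"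
    "\<And>U x. open U \<Longrightarrow> x \<in> U \<Longrightarrow> \<exists>B\<in>\<B>. x \<in> B \<and> B \<subseteq> U"
    using compact_metric_countable_base[OF assms] by blast
  have "S \<in> sets (borel \<Otimes>\<^sub>M borel)" if "open S" for S :: "('a \<times> 'b) set"
  proof -
    define V where "V B = \<Union>{V. open V \<and> B \<times> V \<subseteq> S}" for B
    have "S = (\<Union>B\<in>\<B>. B \<times> V B)"
    proof (intro subset_antisym subsetI)
      fix p assume "p \<in> S"
      with \<open>open S\<close> obtain U W where UW: "open U" "open W" "p \<in> U \<times> W" "U \<times> W \<subseteq> S"
        by (rule open_prod_elim)
      then obtain B where "B \<in> \<B>" "fst p \<in> B" "B \<subseteq> U"
        using \<B>(3)[of U "fst p"] by auto
      moreover from this UW have "snd p \<in> V B"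
        unfolding V_def by (auto intro!: exI[of _ W])
      ultimately show "p \<in> (\<Union>B\<in>\<B>. B \<times> V B)"
        by (cases p) auto
    qed (auto simp: V_def)
    moreover have "open (V B)" for B
      unfolding V_def by (rule open_Union) auto
    then have "B \<times> V B \<in> sets (borel \<Otimes>\<^sub>M borel)" if "B \<in> \<B>" for B
      by (intro pair_measureI borel_open \<B>(2) that)
    then have "(\<Union>B\<in>\<B>. B \<times> V B) \<in> sets (borel \<Otimes>\<^sub>M borel)"
      by (intro sets.countable_UN' \<B>(1)) auto
    ultimately show ?thesis by simp
  qed
  then have "sigma_sets UNIV (Collect open) \<subseteq> sets (borel \<Otimes>\<^sub>M borel :: ('a \<times> 'b) measure)"
    by (intro sets.sigma_sets_subset') auto
  moreover have "sets (borel :: ('a \<times> 'b) measure) = sigma_sets UNIV (Collect open)"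
    by (simp add: borel_def)
  ultimately show "sets (borel :: ('a \<times> 'b) measure) \<subseteq> sets (borel \<Otimes>\<^sub>M borel)"
    by simp
qed

locale compact_borel_prob =
  fixes M :: "'a::metric_space measure"
  assumes compact_UNIV: "compact (UNIV :: 'a set)" and borel_prob: "M \<in> borel_probs"
begin

sublocale prob_space M
  using borel_prob by (simp add: borel_probs_def)

lemma sets_M [measurable_cong, simp]: "sets M = sets borel"
  using borel_prob by (simp add: borel_probs_def)

lemma space_M [simp]: "space M = UNIV"
  using sets_eq_imp_space_eq[OF sets_M] by simp

lemma prob_UNIV [simp]: "prob UNIV = 1"
  using prob_space by simp

lemma measurable_continuous:
  fixes f :: "'a \<Rightarrow> 'b::topological_space"
  shows "continuous_on UNIV f \<Longrightarrow> f \<in> borel_measurable M"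
  using borel_measurable_continuous_onI[of f] measurable_cong_sets[OF sets_M refl] by blast

lemma continuous_bounded:
  fixes f :: "'a \<Rightarrow> real"
  assumes "continuous_on UNIV f"
  obtains K where "\<And>x. \<bar>f x\<bar> \<le> K" "K \<ge> 0"
proof -
  have "bounded (range f)"
    using compact_continuous_image[OF assms compact_UNIV] compact_imp_bounded by blast
  then obtain K where "\<And>x. \<bar>f x\<bar> \<le> K"
    unfolding bounded_iff by auto
  moreover from this[of undefined] have "K \<ge> 0" by linarith
  ultimately show ?thesis using that by blast
qed

lemma integrable_continuous:
  fixes f :: "'a \<Rightarrow> real"
  assumes "continuous_on UNIV f"
  shows "integrable M f"
proof -
  obtain K where "\<And>x. \<bar>f x\<bar> \<le> K" using continuous_bounded[OF assms] by blast
  then show ?thesis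
    by (intro integrable_const_bound[of _ K] measurable_continuous assms) auto
qed

lemma integral_continuous_mono:
  fixes f g :: "'a \<Rightarrow> real"
  assumes "continuous_on UNIV f" "continuous_on UNIV g" "\<And>x. f x \<le> g x"
  shows "(\<integral>x. f x \<partial>M) \<le> (\<integral>x. g x \<partial>M)"
  using assms by (intro integral_mono integrable_continuous) auto

lemma abs_integral_le:
  fixes f :: "'a \<Rightarrow> real"
  assumes "continuous_on UNIV f" "\<And>x. \<bar>f x\<bar> \<le> K"
  shows "\<bar>\<integral>x. f x \<partial>M\<bar> \<le> K"
proof -
  have "\<bar>\<integral>x. f x \<partial>M\<bar> \<le> (\<integral>x. \<bar>f x\<bar> \<partial>M)"
    by (rule integral_abs_bound)
  also have "\<dots> \<le> (\<integral>x. K \<partial>M)"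
    by (intro integral_continuous_mono continuous_intros assms)
  finally show ?thesis by (simp add: prob_space)
qed

lemma integral_uniform_limit:
  fixes f :: "nat \<Rightarrow> 'a \<Rightarrow> real"
  assumes cont: "\<And>n. continuous_on UNIV (f n)" and lim: "uniform_limit UNIV f g sequentially"
  shows "(\<lambda>n. \<integral>x. f n x \<partial>M) \<longlonglongrightarrow> (\<integral>x. g x \<partial>M)"
proof (rule tendstoI)
  have cont_g: "continuous_on UNIV g"
    by (rule uniform_limit_theorem[OF _ lim]) (simp_all add: cont)
  fix e :: real assume "e > 0"
  then have "\<forall>\<^sub>F n in sequentially. \<forall>x\<in>UNIV. dist (f n x) (g x) < e / 2"
    by (intro uniform_limitD[OF lim]) simp
  then show "\<forall>\<^sub>F n in sequentially. dist (\<integral>x. f n x \<partial>M) (\<integral>x. g x \<partial>M) < e"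
  proof eventually_elim
    case (elim n)
    then have "\<bar>\<integral>x. f n x - g x \<partial>M\<bar> \<le> e / 2"
      by (intro abs_integral_le continuous_intros cont cont_g) (auto simp: dist_real_def less_imp_le)
    then show ?case
      using \<open>e > 0\<close> by (simp add: integrable_continuous cont cont_g dist_real_def)
  qed
qed

text \<open>
  Full support only says that each ball has positive mass; compactness makes the bound uniform,
  because every ball of radius \<open>r\<close> contains one of finitely many balls of radius \<open>r / 2\<close>.
\<close>

lemma measure_ball_lower_bound:
  assumes supp: "msupport M = UNIV" and "r > 0"
  obtains m where "m > 0" "\<And>x. m \<le> measure M (ball x r)"
proof -
  obtain D where D: "finite D" "(UNIV :: 'a set) \<subseteq> (\<Union>x\<in>D. ball x (r / 2))"
    by (rule compactE_image[OF compact_UNIV, of UNIV "\<lambda>x. ball x (r / 2)"]) (use \<open>r > 0\<close> in auto)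
  then have "D \<noteq> {}" by auto
  define m where "m = Min ((\<lambda>x. measure M (ball x (r / 2))) ` D)"
  have "0 < measure M (ball x (r / 2))" for x
  proof -
    have "x \<in> msupport M" using supp by simp
    then have "emeasure M (ball x (r / 2)) > 0"
      using \<open>r > 0\<close> unfolding msupport_def by simp
    then show ?thesis by (simp add: emeasure_eq_measure)
  qed
  then have "m > 0"
    using D(1) \<open>D \<noteq> {}\<close> by (auto simp: m_def)
  moreover have "m \<le> measure M (ball x r)" for x
  proof -
    obtain d where d: "d \<in> D" "dist d x < r / 2"
      using subsetD[OF D(2), of x] by auto
    have "ball d (r / 2) \<subseteq> ball x r"
    proof
      fix z assume "z \<in> ball d (r / 2)"
      then show "z \<in> ball x r"
        using dist_triangle[of x z d] d by (simp add: dist_commute)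
    qed
    then have "measure M (ball d (r / 2)) \<le> measure M (ball x r)"
      by (intro finite_measure_mono) auto
    moreover have "m \<le> measure M (ball d (r / 2))"
      unfolding m_def using D(1) d by auto
    ultimately show ?thesis by simp
  qed
  ultimately show ?thesis using that by blast
qed

text \<open>
  The indicator of a closed set is the limit of the continuous functions
  \<open>max 0 (1 - n * infdist x C)\<close>, so the two measures agree on closed sets, which generate.
\<close>

lemma eq_if_continuous_integrals_eq:
  assumes N: "N \<in> borel_probs"
    and eq: "\<And>f :: 'a \<Rightarrow> real. continuous_on UNIV f \<Longrightarrow> (\<integral>x. f x \<partial>M) = (\<integral>x. f x \<partial>N)"
  shows "M = N"
proof -
  interpret N: compact_borel_prob N
    by unfold_locales (use N compact_UNIV in auto)
  have closed_eq: "emeasure M C = emeasure N C" if "closed C" for C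
  proof (cases "C = {}")
    case False
    define f where "f n x = max 0 (1 - real n * infdist x C)" for n x
    have cont: "continuous_on UNIV (f n)" for n
      unfolding f_def by (intro continuous_intros)
    have bd: "\<bar>f n x\<bar> \<le> 1" for n x
      by (auto simp: f_def infdist_nonneg)
    have lim: "(\<lambda>n. f n x) \<longlonglongrightarrow> indicator C x" for x
    proof (cases "x \<in> C")
      case False
      have "infdist x C > 0"
        using False \<open>closed C\<close> \<open>C \<noteq> {}\<close> in_closed_iff_infdist_zero infdist_nonneg[of x C] by force
      then obtain n0 where n0: "1 < real n0 * infdist x C"
        using reals_Archimedean3 by blast
      have "f n x = 0" if "n \<ge> n0" for n
      proof -
        have "real n0 * infdist x C \<le> real n * infdist x C"
          using that by (intro mult_right_mono) (auto simp: infdist_nonneg)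
        with n0 show ?thesis by (simp add: f_def)
      qed
      then have "eventually (\<lambda>n. f n x = indicator C x) sequentially"
        using False unfolding eventually_sequentially by auto
      then show ?thesis by (rule tendsto_eventually)
    qed (simp add: f_def)
    have "(\<lambda>n. \<integral>x. f n x \<partial>K) \<longlonglongrightarrow> (\<integral>x. indicator C x \<partial>K)"
      if "compact_borel_prob K" for K
    proof -
      interpret K: compact_borel_prob K by fact
      show ?thesis
        by (rule integral_dominated_convergence[where w = "\<lambda>_. 1"])
          (use \<open>closed C\<close> in \<open>auto intro!: K.measurable_continuous cont lim borel_measurable_indicator simp: bd\<close>)
    qed
    note L = this
    have "(\<integral>x. indicat_real C x \<partial>M) = (\<integral>x. indicat_real C x \<partial>N)"
      using LIMSEQ_unique[OF L[OF compact_borel_prob_axioms]] L[OF N.compact_borel_prob_axioms]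
      by (simp add: eq[OF cont])
    then show ?thesis
      by (simp add: emeasure_eq_measure N.emeasure_eq_measure)
  qed simp
  show ?thesis
    by (rule measure_eqI_generator_eq[where E = "Collect closed" and \<Omega> = UNIV and A = "\<lambda>_. UNIV"])
      (auto simp: Int_stable_def closed_eq sets_measure_of borel_eq_closed)
qed

end

section \<open>The log-partition functional\<close>

definition log_partition :: "'a measure \<Rightarrow> ('a \<Rightarrow> real) \<Rightarrow> real" where
  "log_partition M f = ln (\<integral>x. exp (f x) \<partial>M)"

context compact_borel_prob
begin

lemma integral_exp_pos:
  fixes f :: "'a \<Rightarrow> real"
  assumes "continuous_on UNIV f"
  shows "0 < (\<integral>x. exp (f x) \<partial>M)"
proof -
  obtain K where K: "\<And>x. \<bar>f x\<bar> \<le> K" using continuous_bounded[OF assms] by blast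
  have "exp (- K) = (\<integral>x. exp (- K) \<partial>M)" by (simp add: prob_space)
  also have "\<dots> \<le> (\<integral>x. exp (f x) \<partial>M)"
  proof (intro integral_continuous_mono continuous_intros assms)
    show "exp (- K) \<le> exp (f x)" for x using K[of x] by simp
  qed
  finally show ?thesis using exp_gt_zero[of "- K"] by linarith
qed

lemma exp_log_partition:
  "continuous_on UNIV f \<Longrightarrow> exp (log_partition M f) = (\<integral>x. exp (f x) \<partial>M)"
  by (simp add: log_partition_def integral_exp_pos)

lemma integral_exp_shift_eq_1_iff:
  assumes "continuous_on UNIV f"
  shows "(\<integral>x. exp (f x + u) \<partial>M) = 1 \<longleftrightarrow> u = - log_partition M f"
proof -
  have "(\<integral>x. exp (f x + u) \<partial>M) = exp (log_partition M f + u)"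
    by (simp add: exp_add exp_log_partition assms)
  then show ?thesis by auto
qed

lemma log_partition_le_shift:
  assumes "continuous_on UNIV f" "continuous_on UNIV g" "\<And>x. f x \<le> g x + d"
  shows "log_partition M f \<le> log_partition M g + d"
proof -
  have "exp (log_partition M f) = (\<integral>x. exp (f x) \<partial>M)"
    by (simp add: exp_log_partition assms)
  also have "\<dots> \<le> (\<integral>x. exp (g x + d) \<partial>M)"
    by (intro integral_continuous_mono continuous_intros assms) (simp add: assms)
  also have "\<dots> = exp (log_partition M g + d)"
    by (simp add: exp_add exp_log_partition assms)
  finally show ?thesis by simp
qed

lemma log_partition_abs_diff_le:
  assumes "continuous_on UNIV f" "continuous_on UNIV g" "\<And>x. \<bar>f x - g x\<bar> \<le> d"
  shows "\<bar>log_partition M f - log_partition M g\<bar> \<le> d"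
proof -
  have "f x \<le> g x + d" "g x \<le> f x + d" for x using assms(3)[of x] by linarith+
  then have "log_partition M f \<le> log_partition M g + d" "log_partition M g \<le> log_partition M f + d"
    using assms by (auto intro!: log_partition_le_shift)
  then show ?thesis by linarith
qed

text \<open>
  With \<open>h = exp (\<phi> - \<phi>')\<close>, the difference \<open>F (k + \<phi>) - F (k + \<phi>')\<close> is the logarithm of the mean
  \<open>m k\<close> of \<open>h\<close> under the probability proportional to \<open>exp (k + \<phi>')\<close>.  For kernels within \<open>\<delta>\<close> of each
  other these probabilities dominate each other up to the factor \<open>\<epsilon> = exp (- 2 \<delta>)\<close>.  Hence the
  average of \<open>R - h \<ge> 0\<close> under one is at least \<open>\<epsilon>\<close> times its average under the other, that is
  \<open>m k \<le> \<epsilon> m k' + (1 - \<epsilon>) R\<close>.  Measuring oscillation as \<open>E = exp osc - 1\<close> rather than as \<open>osc\<close> makes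
  the resulting contraction linear.
\<close>

lemma log_partition_contraction:
  assumes cont: "continuous_on UNIV k" "continuous_on UNIV k'" "continuous_on UNIV \<phi>" "continuous_on UNIV \<phi>'"
    and kk: "\<And>x. \<bar>k x - k' x\<bar> \<le> \<delta>"
    and osc: "\<And>x x'. exp ((\<phi> x - \<phi>' x) - (\<phi> x' - \<phi>' x')) \<le> 1 + E"
  defines "F \<equiv> log_partition M"
  shows "exp ((F (\<lambda>x. k x + \<phi> x) - F (\<lambda>x. k x + \<phi>' x)) - (F (\<lambda>x. k' x + \<phi> x) - F (\<lambda>x. k' x + \<phi>' x)))
    \<le> 1 + (1 - exp (- (2 * \<delta>))) * E"
proof -
  define h where "h x = exp (\<phi> x - \<phi>' x)" for x
  have h_cont: "continuous_on UNIV h"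
    unfolding h_def by (intro continuous_intros cont)
  obtain a where a: "\<And>x. h a \<le> h x"
    using continuous_attains_inf[OF compact_UNIV _ h_cont] by auto
  \<comment> \<open>The minimum of \<open>h\<close> is attained by compactness; together with the bound on the oscillation it
    also yields the upper bound \<open>R\<close>.\<close>
  define r where "r = h a"
  have r: "r > 0" "\<And>x. r \<le> h x" using a by (auto simp: r_def h_def)
  define R where "R = (1 + E) * r"
  have hR: "h x \<le> R" for x
    using mult_right_mono[OF osc[of x a], of r] r(1)
    by (simp add: R_def r_def h_def exp_diff)
  have "E \<ge> 0" using osc[of a a] by simp
  define \<epsilon> where "\<epsilon> = exp (- (2 * \<delta>))"
  have "\<delta> \<ge> 0" using kk[of a] by linarith
  then have \<epsilon>: "0 < \<epsilon>" "\<epsilon> \<le> 1" by (auto simp: \<epsilon>_def)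
  \<comment> \<open>\<open>m k\<close> is the mean of \<open>h\<close> under the probability proportional to \<open>exp (k + \<phi>')\<close>.\<close>
  define Z where "Z k = (\<integral>x. exp (k x + \<phi>' x) \<partial>M)" for k
  define m where "m k = (\<integral>x. h x * exp (k x + \<phi>' x) \<partial>M) / Z k" for k
  have Zpos: "Z k > 0" if "continuous_on UNIV k" for k
    unfolding Z_def by (intro integral_exp_pos continuous_intros that cont)
  have Fm: "exp (F (\<lambda>x. k x + \<phi> x) - F (\<lambda>x. k x + \<phi>' x)) = m k" if "continuous_on UNIV k" for k
  proof -
    have "(\<integral>x. exp (k x + \<phi> x) \<partial>M) = (\<integral>x. h x * exp (k x + \<phi>' x) \<partial>M)"
      by (intro Bochner_Integration.integral_cong refl) (simp add: h_def exp_add[symmetric])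
    then show ?thesis
      by (simp add: F_def exp_diff exp_log_partition continuous_on_add that cont m_def Z_def)
  qed
  have mr: "r \<le> m k" if "continuous_on UNIV k" for k
  proof -
    have "r * Z k = (\<integral>x. r * exp (k x + \<phi>' x) \<partial>M)" by (simp add: Z_def)
    also have "\<dots> \<le> (\<integral>x. h x * exp (k x + \<phi>' x) \<partial>M)"
      by (intro integral_continuous_mono continuous_intros that cont h_cont) (simp add: r)
    finally show ?thesis using Zpos[OF that] by (simp add: m_def field_simps)
  qed
  have def_int: "(\<integral>x. (R - h x) * exp (k x + \<phi>' x) \<partial>M) = (R - m k) * Z k" if "continuous_on UNIV k" for k
  proof -
    have "(\<integral>x. (R - h x) * exp (k x + \<phi>' x) \<partial>M)
      = (\<integral>x. R * exp (k x + \<phi>' x) \<partial>M) - (\<integral>x. h x * exp (k x + \<phi>' x) \<partial>M)"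
      unfolding left_diff_distrib
      by (intro Bochner_Integration.integral_diff integrable_continuous continuous_intros that cont h_cont)
    also have "\<dots> = (R - m k) * Z k"
      using Zpos[OF that] by (simp add: m_def Z_def left_diff_distrib)
    finally show ?thesis .
  qed
  have kle: "k x \<le> k' x + \<delta>" "k' x \<le> k x + \<delta>" for x using kk[of x] by linarith+
  have "exp (- \<delta>) * ((R - m k') * Z k') = (\<integral>x. exp (- \<delta>) * ((R - h x) * exp (k' x + \<phi>' x)) \<partial>M)"
    by (simp add: def_int cont)
  also have "\<dots> \<le> (\<integral>x. (R - h x) * exp (k x + \<phi>' x) \<partial>M)"
  proof (intro integral_continuous_mono continuous_intros cont h_cont)
    fix x
    have "exp (- \<delta>) * exp (k' x + \<phi>' x) \<le> exp (k x + \<phi>' x)"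
      using kle[of x] by (simp add: exp_add[symmetric])
    from mult_left_mono[OF this, of "R - h x"] hR[of x]
    show "exp (- \<delta>) * ((R - h x) * exp (k' x + \<phi>' x)) \<le> (R - h x) * exp (k x + \<phi>' x)"
      by (simp add: mult_ac)
  qed
  also have "\<dots> = (R - m k) * Z k" by (simp add: def_int cont)
  finally have 1: "exp (- \<delta>) * ((R - m k') * Z k') \<le> (R - m k) * Z k" .
  have "exp (- \<delta>) * Z k = (\<integral>x. exp (- \<delta>) * exp (k x + \<phi>' x) \<partial>M)" by (simp add: Z_def)
  also have "\<dots> \<le> Z k'"
    unfolding Z_def
    by (intro integral_continuous_mono continuous_intros cont) (use kle in \<open>auto simp: exp_add[symmetric] algebra_simps\<close>)
  finally have 2: "exp (- \<delta>) * Z k \<le> Z k'" .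
  have Rm: "m k' \<le> R"
  proof -
    have "0 \<le> (\<integral>x. (R - h x) * exp (k' x + \<phi>' x) \<partial>M)"
      by (rule Bochner_Integration.integral_nonneg) (simp add: hR)
    then show ?thesis using def_int[OF cont(2)] Zpos[OF cont(2)] by (simp add: zero_le_mult_iff)
  qed
  have "\<epsilon> * (R - m k') * Z k = exp (- \<delta>) * ((R - m k') * (exp (- \<delta>) * Z k))"
  proof -
    have "\<epsilon> = exp (- \<delta>) * exp (- \<delta>)" by (simp add: \<epsilon>_def mult_exp_exp)
    then show ?thesis by (simp add: mult_ac)
  qed
  also have "\<dots> \<le> exp (- \<delta>) * ((R - m k') * Z k')"
    using Rm 2 by (intro mult_left_mono) auto
  finally have "\<epsilon> * (R - m k') * Z k \<le> (R - m k) * Z k" using 1 by linarith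
  then have "\<epsilon> * (R - m k') \<le> R - m k" using Zpos[OF cont(1)] by simp
  then have "m k \<le> m k' + (1 - \<epsilon>) * (R - m k')" by (simp add: algebra_simps)
  also have "\<dots> \<le> m k' + (1 - \<epsilon>) * (E * m k')"
  proof -
    have "R - m k' \<le> E * r" using mr[OF cont(2)] by (simp add: R_def algebra_simps)
    also have "\<dots> \<le> E * m k'" using mr[OF cont(2)] \<open>E \<ge> 0\<close> by (rule mult_left_mono)
    finally show ?thesis using \<epsilon> by (simp add: mult_left_mono)
  qed
  finally have "m k \<le> (1 + (1 - \<epsilon>) * E) * m k'" by (simp add: algebra_simps)
  moreover have "m k' > 0" using mr[OF cont(2)] r(1) by linarith
  ultimately have "m k / m k' \<le> 1 + (1 - \<epsilon>) * E" by (simp add: field_simps)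
  then show ?thesis
    by (simp add: exp_diff[of "F _ - F _"] Fm cont \<epsilon>_def)
qed

text \<open>
  Given the potential on one factor, the soft transform is the potential on the other factor that
  solves one of the two normalizing identities.  It is the smooth analogue of the c-transform.
\<close>

definition soft_transform :: "('a \<Rightarrow> 'z \<Rightarrow> real) \<Rightarrow> ('a \<Rightarrow> real) \<Rightarrow> 'z \<Rightarrow> real" where
  "soft_transform k \<phi> z = - log_partition M (\<lambda>x. k x z + \<phi> x)"

lemma integral_exp_eq_1_iff_soft_transform:
  assumes "continuous_on UNIV (\<lambda>x. k x z)" "continuous_on UNIV \<phi>"
  shows "(\<integral>x. exp (k x z + \<phi> x + u) \<partial>M) = 1 \<longleftrightarrow> u = soft_transform k \<phi> z"
  unfolding soft_transform_def
  by (intro integral_exp_shift_eq_1_iff continuous_intros assms)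

lemma soft_transform_nonexpansive:
  assumes "continuous_on UNIV (\<lambda>x. k x z)" "continuous_on UNIV \<phi>" "continuous_on UNIV \<phi>'"
    and "\<And>x. \<bar>\<phi> x - \<phi>' x\<bar> \<le> d"
  shows "\<bar>soft_transform k \<phi> z - soft_transform k \<phi>' z\<bar> \<le> d"
proof -
  have "\<bar>log_partition M (\<lambda>x. k x z + \<phi> x) - log_partition M (\<lambda>x. k x z + \<phi>' x)\<bar> \<le> d"
    by (intro log_partition_abs_diff_le continuous_intros assms(1-3)) (simp add: assms(4))
  then show ?thesis by (simp add: soft_transform_def abs_minus_commute)
qed

lemma soft_transform_modulus:
  assumes "\<And>z. continuous_on UNIV (\<lambda>x. k x z)" "continuous_on UNIV \<phi>"
    and "\<And>x. \<bar>k x z - k x z'\<bar> \<le> d"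
  shows "\<bar>soft_transform k \<phi> z - soft_transform k \<phi> z'\<bar> \<le> d"
proof -
  have "\<bar>log_partition M (\<lambda>x. k x z + \<phi> x) - log_partition M (\<lambda>x. k x z' + \<phi> x)\<bar> \<le> d"
    by (intro log_partition_abs_diff_le continuous_intros assms(1-2)) (simp add: assms(3))
  then show ?thesis by (simp add: soft_transform_def abs_minus_commute)
qed

lemma soft_transform_shift:
  assumes "continuous_on UNIV (\<lambda>x. k x z)" "continuous_on UNIV \<phi>"
  shows "soft_transform k (\<lambda>x. \<phi> x + d) z = soft_transform k \<phi> z - d"
proof -
  have "(\<integral>x. exp (k x z + \<phi> x + soft_transform k \<phi> z) \<partial>M) = 1"
    using integral_exp_eq_1_iff_soft_transform[of k z \<phi> "soft_transform k \<phi> z"] assms by simp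
  then have "(\<integral>x. exp (k x z + (\<phi> x + d) + (soft_transform k \<phi> z - d)) \<partial>M) = 1"
    by (simp add: algebra_simps)
  moreover have "continuous_on UNIV (\<lambda>x. \<phi> x + d)"
    by (intro continuous_intros assms)
  ultimately show ?thesis
    using integral_exp_eq_1_iff_soft_transform[of k z "\<lambda>x. \<phi> x + d" "soft_transform k \<phi> z - d"] assms(1)
    by simp
qed

end

text \<open>
  The bound says \<open>exp (osc (f - g)) - 1 \<le> E\<close>.  It is stated on pairs of points to avoid suprema, and it
  ignores additive constants, which are exactly the freedom in a solution.
\<close>

definition exp_osc_le :: "('a \<Rightarrow> real) \<Rightarrow> ('a \<Rightarrow> real) \<Rightarrow> real \<Rightarrow> bool" where
  "exp_osc_le f g E \<longleftrightarrow> (\<forall>x x'. exp ((f x - g x) - (f x' - g x')) \<le> 1 + E)"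

context compact_borel_prob
begin

lemma exp_osc_le_exists:
  fixes f g :: "'a \<Rightarrow> real"
  assumes "continuous_on UNIV f" "continuous_on UNIV g"
  obtains E where "exp_osc_le f g E"
proof -
  obtain K where K: "\<And>x. \<bar>f x - g x\<bar> \<le> K"
    using continuous_bounded[of "\<lambda>x. f x - g x"] assms by (auto intro!: continuous_intros)
  have "exp ((f x - g x) - (f x' - g x')) \<le> 1 + (exp (2 * K) - 1)" for x x'
    using K[of x] K[of x'] by simp
  then show ?thesis using that[of "exp (2 * K) - 1"] by (simp add: exp_osc_le_def)
qed

lemma soft_transform_contraction:
  assumes "\<And>z. continuous_on UNIV (\<lambda>x. k x z)" "continuous_on UNIV \<phi>" "continuous_on UNIV \<phi>'"
    and "\<And>x z z'. \<bar>k x z - k x z'\<bar> \<le> \<delta>" and "exp_osc_le \<phi> \<phi>' E"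
  shows "exp_osc_le (soft_transform k \<phi>) (soft_transform k \<phi>') ((1 - exp (- (2 * \<delta>))) * E)"
  unfolding exp_osc_le_def
proof (intro allI)
  fix z z'
  show "exp ((soft_transform k \<phi> z - soft_transform k \<phi>' z)
      - (soft_transform k \<phi> z' - soft_transform k \<phi>' z')) \<le> 1 + (1 - exp (- (2 * \<delta>))) * E"
    using log_partition_contraction[of "\<lambda>x. k x z'" "\<lambda>x. k x z" \<phi> \<phi>' \<delta> E] assms
    by (simp add: soft_transform_def exp_osc_le_def algebra_simps)
qed

end

section \<open>Schroedinger systems\<close>

locale lipschitz_transport =
  fixes \<mu> :: "'a::metric_space measure" and \<nu> :: "'b::metric_space measure"
    and A :: "'a \<times> 'b \<Rightarrow> real" and L :: real
  assumes compact_X: "compact (UNIV :: 'a set)" and compact_Y: "compact (UNIV :: 'b set)"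
    and borel_probs: "\<mu> \<in> borel_probs" "\<nu> \<in> borel_probs"
    and lipschitz_A: "lipschitz_wrt sum_dist L A"
begin

sublocale X: compact_borel_prob \<mu>
  by unfold_locales (auto simp: compact_X borel_probs)

sublocale Y: compact_borel_prob \<nu>
  by unfold_locales (auto simp: compact_Y borel_probs)

lemma sets_product: "sets (\<mu> \<Otimes>\<^sub>M \<nu>) = sets borel"
  using sets_pair_measure_cong[OF X.sets_M Y.sets_M] sets_borel_prod_compact[OF compact_X] by simp

sublocale pair_prob_space \<mu> \<nu>
  by unfold_locales

sublocale P: compact_borel_prob "\<mu> \<Otimes>\<^sub>M \<nu>"
proof unfold_locales
  show "compact (UNIV :: ('a \<times> 'b) set)"
    using compact_Times[OF compact_X compact_Y] by simp
  show "\<mu> \<Otimes>\<^sub>M \<nu> \<in> borel_probs"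
    using sets_product prob_space_axioms by (simp add: borel_probs_def)
qed

lemma L_nonneg: "L \<ge> 0"
  using lipschitz_A by (simp add: lipschitz_wrt_def)

lemma A_lipschitz: "\<bar>A (x, y) - A (x', y')\<bar> \<le> L * (dist x x' + dist y y')"
  using lipschitz_A by (auto simp: lipschitz_wrt_def sum_dist_def)

lemma continuous_A: "continuous_on UNIV A"
proof (rule lipschitz_on_continuous_on)
  show "(L * 2)-lipschitz_on UNIV A"
  proof (rule lipschitz_onI)
    fix p q :: "'a \<times> 'b"
    have "dist (A p) (A q) \<le> L * (dist (fst p) (fst q) + dist (snd p) (snd q))"
      using A_lipschitz[of "fst p" "snd p" "fst q" "snd q"] by (simp add: dist_real_def)
    also have "\<dots> \<le> L * (dist p q + dist p q)"
      using L_nonneg by (intro mult_left_mono add_mono dist_fst_le dist_snd_le)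
    finally show "dist (A p) (A q) \<le> L * 2 * dist p q" by simp
  qed (use L_nonneg in simp)
qed

lemma continuous_A_comp [continuous_intros]:
  "continuous_on UNIV f \<Longrightarrow> continuous_on UNIV g \<Longrightarrow> continuous_on UNIV (\<lambda>z. A (f z, g z))"
  by (rule continuous_on_compose2[OF continuous_A]) (auto intro: continuous_intros)

abbreviation x_transform :: "real \<Rightarrow> ('b \<Rightarrow> real) \<Rightarrow> 'a \<Rightarrow> real" where
  "x_transform \<beta> \<equiv> Y.soft_transform (\<lambda>y x. \<beta> * A (x, y))"

abbreviation y_transform :: "real \<Rightarrow> ('a \<Rightarrow> real) \<Rightarrow> 'b \<Rightarrow> real" where
  "y_transform \<beta> \<equiv> X.soft_transform (\<lambda>x y. \<beta> * A (x, y))"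

lemma normalizing_pair_iff:
  "normalizing_pair \<mu> \<nu> A \<beta> \<phi> \<psi> \<longleftrightarrow> continuous_on UNIV \<phi> \<and> continuous_on UNIV \<psi> \<and>
     \<psi> = y_transform \<beta> \<phi> \<and> \<phi> = x_transform \<beta> \<psi>"
proof -
  have "(\<integral>x. exp (\<beta> * A (x, y) + \<phi> x + \<psi> y) \<partial>\<mu>) = 1 \<longleftrightarrow> \<psi> y = y_transform \<beta> \<phi> y"
    if "continuous_on UNIV \<phi>" for y
    by (rule X.integral_exp_eq_1_iff_soft_transform) (intro continuous_intros that)+
  moreover have "(\<integral>y. exp (\<beta> * A (x, y) + \<phi> x + \<psi> y) \<partial>\<nu>) = 1 \<longleftrightarrow> \<phi> x = x_transform \<beta> \<psi> x"
    if "continuous_on UNIV \<psi>" for x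
    using Y.integral_exp_eq_1_iff_soft_transform[of "\<lambda>y x. \<beta> * A (x, y)" x \<psi> "\<phi> x"] that
    by (simp add: continuous_intros add_ac)
  ultimately show ?thesis
    unfolding normalizing_pair_def fun_eq_iff by blast
qed

lemma x_transform_lipschitz:
  assumes "\<beta> \<ge> 0" "continuous_on UNIV \<psi>"
  shows "lipschitz_wrt dist (\<beta> * L) (x_transform \<beta> \<psi>)"
proof -
  have "\<bar>\<beta> * A (x, y) - \<beta> * A (x', y)\<bar> \<le> \<beta> * L * dist x x'" for x x' y
    using mult_left_mono[OF A_lipschitz[of x y x' y] assms(1)] assms(1)
    by (simp add: right_diff_distrib[symmetric] abs_mult mult.assoc)
  then show ?thesis
    using assms L_nonneg unfolding lipschitz_wrt_def
    by (auto intro!: Y.soft_transform_modulus continuous_intros)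
qed

lemma y_transform_lipschitz:
  assumes "\<beta> \<ge> 0" "continuous_on UNIV \<phi>"
  shows "lipschitz_wrt dist (\<beta> * L) (y_transform \<beta> \<phi>)"
proof -
  have "\<bar>\<beta> * A (x, y) - \<beta> * A (x, y')\<bar> \<le> \<beta> * L * dist y y'" for x y y'
    using mult_left_mono[OF A_lipschitz[of x y x y'] assms(1)] assms(1)
    by (simp add: right_diff_distrib[symmetric] abs_mult mult.assoc)
  then show ?thesis
    using assms L_nonneg unfolding lipschitz_wrt_def
    by (auto intro!: X.soft_transform_modulus continuous_intros)
qed

lemma normalizing_pair_lipschitz:
  assumes "\<beta> > 0" "normalizing_pair \<mu> \<nu> A \<beta> \<phi> \<psi>"
  shows "lipschitz_wrt dist (\<beta> * L) \<phi>" "lipschitz_wrt dist (\<beta> * L) \<psi>"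
proof -
  from assms(2) have *: "continuous_on UNIV \<phi>" "continuous_on UNIV \<psi>"
    "\<psi> = y_transform \<beta> \<phi>" "\<phi> = x_transform \<beta> \<psi>"
    unfolding normalizing_pair_iff by blast+
  show "lipschitz_wrt dist (\<beta> * L) \<phi>"
    by (subst *(4), rule x_transform_lipschitz) (use assms(1) *(2) in auto)
  show "lipschitz_wrt dist (\<beta> * L) \<psi>"
    by (subst *(3), rule y_transform_lipschitz) (use assms(1) *(1) in auto)
qed

lemma continuous_transforms:
  fixes \<phi> :: "'a \<Rightarrow> real" and \<psi> :: "'b \<Rightarrow> real"
  assumes "\<beta> > 0"
  shows "continuous_on UNIV \<psi> \<Longrightarrow> continuous_on UNIV (x_transform \<beta> \<psi>)"
    and "continuous_on UNIV \<phi> \<Longrightarrow> continuous_on UNIV (y_transform \<beta> \<phi>)"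
  using x_transform_lipschitz[of \<beta> \<psi>] y_transform_lipschitz[of \<beta> \<phi>] assms
  by (auto simp: lipschitz_wrt_dist intro: lipschitz_on_continuous_on)

definition sinkhorn :: "real \<Rightarrow> ('a \<Rightarrow> real) \<Rightarrow> 'a \<Rightarrow> real" where
  "sinkhorn \<beta> \<phi> = x_transform \<beta> (y_transform \<beta> \<phi>)"

lemma continuous_sinkhorn:
  "\<beta> > 0 \<Longrightarrow> continuous_on UNIV \<phi> \<Longrightarrow> continuous_on UNIV (sinkhorn \<beta> \<phi>)"
  unfolding sinkhorn_def by (intro continuous_transforms)

lemma sinkhorn_nonexpansive:
  assumes "\<beta> > 0" "continuous_on UNIV \<phi>" "continuous_on UNIV \<phi>'" "\<And>x. \<bar>\<phi> x - \<phi>' x\<bar> \<le> d"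
  shows "\<bar>sinkhorn \<beta> \<phi> x - sinkhorn \<beta> \<phi>' x\<bar> \<le> d"
  unfolding sinkhorn_def using assms
  by (intro Y.soft_transform_nonexpansive X.soft_transform_nonexpansive continuous_transforms
      continuous_intros) auto

text \<open>
  Both transforms contract with the factor \<open>1 - exp (- 2 \<delta>)\<close>, where \<open>\<delta> = 2 \<beta> K\<close>, for a bound \<open>K\<close> of
  \<open>\<bar>A\<bar>\<close>, bounds the oscillation of the kernel \<open>\<beta> A\<close>; \<open>q\<close> is the product of the two factors.
\<close>

lemma sinkhorn_contraction:
  assumes "\<beta> > 0"
  obtains q where "0 \<le> q" "q < 1"
    "\<And>(\<phi> :: 'a \<Rightarrow> real) \<phi>' E. continuous_on UNIV \<phi> \<Longrightarrow> continuous_on UNIV \<phi>' \<Longrightarrow> exp_osc_le \<phi> \<phi>' E \<Longrightarrow>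
       exp_osc_le (sinkhorn \<beta> \<phi>) (sinkhorn \<beta> \<phi>') (q * E)"
proof -
  obtain K where K: "\<And>z. \<bar>A z\<bar> \<le> K" "K \<ge> 0"
    using P.continuous_bounded[OF continuous_A] by blast
  define \<delta> where "\<delta> = \<beta> * (2 * K)"
  have "\<delta> \<ge> 0" using K assms by (simp add: \<delta>_def)
  have \<delta>: "\<bar>\<beta> * A z - \<beta> * A w\<bar> \<le> \<delta>" for z w
  proof -
    have "\<bar>\<beta> * A z - \<beta> * A w\<bar> = \<beta> * \<bar>A z - A w\<bar>"
      using assms by (simp add: right_diff_distrib[symmetric] abs_mult)
    also have "\<dots> \<le> \<beta> * (2 * K)"
      using K(1)[of z] K(1)[of w] assms by (intro mult_left_mono) auto
    finally show ?thesis by (simp add: \<delta>_def)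
  qed
  define q where "q = 1 - exp (- (2 * \<delta>))"
  have q: "0 \<le> q" "q < 1" using \<open>\<delta> \<ge> 0\<close> by (auto simp: q_def)
  show ?thesis
  proof (rule that[of "q * q"])
    show "q * q < 1" using q mult_strict_mono[of q 1 q 1] by (cases "q = 0") auto
    fix \<phi> \<phi>' :: "'a \<Rightarrow> real" and E
    assume cont: "continuous_on UNIV \<phi>" "continuous_on UNIV \<phi>'" and "exp_osc_le \<phi> \<phi>' E"
    then have "exp_osc_le (y_transform \<beta> \<phi>) (y_transform \<beta> \<phi>') (q * E)"
      unfolding q_def by (intro X.soft_transform_contraction continuous_intros \<delta>)
    then have "exp_osc_le (sinkhorn \<beta> \<phi>) (sinkhorn \<beta> \<phi>') (q * (q * E))"
      unfolding q_def sinkhorn_def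
      by (intro Y.soft_transform_contraction continuous_intros \<delta> continuous_transforms cont assms)
    then show "exp_osc_le (sinkhorn \<beta> \<phi>) (sinkhorn \<beta> \<phi>') (q * q * E)"
      by (simp add: mult.assoc)
  qed (use q in auto)
qed

text \<open>
  Both first components are fixed points, so the contraction can be applied to the same pair
  arbitrarily often, and the oscillation of their difference must vanish.
\<close>

theorem normalizing_pair_unique:
  assumes "\<beta> > 0" "normalizing_pair \<mu> \<nu> A \<beta> \<phi> \<psi>" "normalizing_pair \<mu> \<nu> A \<beta> \<phi>' \<psi>'"
  shows "\<exists>d. (\<forall>x. \<phi>' x = \<phi> x + d) \<and> (\<forall>y. \<psi>' y = \<psi> y - d)"
proof -
  obtain q where q: "0 \<le> q" "q < 1"
    "\<And>(\<phi> :: 'a \<Rightarrow> real) \<phi>' E. continuous_on UNIV \<phi> \<Longrightarrow> continuous_on UNIV \<phi>' \<Longrightarrow> exp_osc_le \<phi> \<phi>' E \<Longrightarrow>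
       exp_osc_le (sinkhorn \<beta> \<phi>) (sinkhorn \<beta> \<phi>') (q * E)"
    using sinkhorn_contraction[OF assms(1)] by metis
  have cont: "continuous_on UNIV \<phi>" "continuous_on UNIV \<phi>'"
    and \<psi>: "\<psi> = y_transform \<beta> \<phi>" "\<psi>' = y_transform \<beta> \<phi>'"
    and \<phi>: "\<phi> = x_transform \<beta> \<psi>" "\<phi>' = x_transform \<beta> \<psi>'"
    using assms(2,3) unfolding normalizing_pair_iff by blast+
  have fixp: "sinkhorn \<beta> \<phi> = \<phi>" "sinkhorn \<beta> \<phi>' = \<phi>'"
    unfolding sinkhorn_def by (simp_all only: \<psi>[symmetric] \<phi>[symmetric])
  obtain E where E: "exp_osc_le \<phi> \<phi>' E" using X.exp_osc_le_exists[OF cont] by blast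
  have osc: "exp_osc_le \<phi> \<phi>' (q ^ n * E)" for n
  proof (induction n)
    case (Suc n)
    show ?case using q(3)[OF cont Suc] by (simp add: fixp mult.assoc)
  qed (simp add: E)
  have le: "\<phi> x - \<phi>' x \<le> \<phi> x' - \<phi>' x'" for x x'
  proof -
    have "(\<lambda>n. 1 + q ^ n * E) \<longlonglongrightarrow> 1 + 0 * E"
      using q by (intro tendsto_intros LIMSEQ_power_zero) auto
    then have "exp ((\<phi> x - \<phi>' x) - (\<phi> x' - \<phi>' x')) \<le> 1 + 0 * E"
      by (rule Lim_bounded2) (use osc in \<open>auto simp: exp_osc_le_def\<close>)
    then show ?thesis by simp
  qed
  define d where "d = \<phi>' undefined - \<phi> undefined"
  have d: "\<phi>' x = \<phi> x + d" for x
    using le[of x undefined] le[of undefined x] by (simp add: d_def)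
  then have "\<psi>' = y_transform \<beta> (\<lambda>x. \<phi> x + d)"
    using \<psi>(2) by presburger
  then have "\<psi>' y = \<psi> y - d" for y
    by (simp add: \<psi>(1) X.soft_transform_shift continuous_intros cont)
  with d show ?thesis by blast
qed

text \<open>
  The contraction sees functions only up to constants.  Subtracting the value at the base point \<open>x0\<close>
  in every step turns oscillation bounds into uniform ones, at the price of a limit that solves the
  equation only up to a constant \<open>l\<close>.  Integrating the density over \<open>x\<close> first gives total mass \<open>1\<close>,
  over \<open>y\<close> first it gives \<open>exp (- l)\<close>, so Fubini yields \<open>l = 0\<close>.
\<close>

theorem normalizing_pair_exists:
  assumes "\<beta> > 0"
  shows "\<exists>\<phi> \<psi>. normalizing_pair \<mu> \<nu> A \<beta> \<phi> \<psi>"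
proof -
  obtain q where q: "0 \<le> q" "q < 1"
    "\<And>(\<phi> :: 'a \<Rightarrow> real) \<phi>' E. continuous_on UNIV \<phi> \<Longrightarrow> continuous_on UNIV \<phi>' \<Longrightarrow> exp_osc_le \<phi> \<phi>' E \<Longrightarrow>
       exp_osc_le (sinkhorn \<beta> \<phi>) (sinkhorn \<beta> \<phi>') (q * E)"
    using sinkhorn_contraction[OF assms] by metis
  define x0 :: 'a where "x0 = undefined"
  define \<Phi> where "\<Phi> n = ((\<lambda>\<phi> x. sinkhorn \<beta> \<phi> x - sinkhorn \<beta> \<phi> x0) ^^ n) (\<lambda>_. 0)" for n
  have \<Phi>_0: "\<Phi> 0 = (\<lambda>_. 0)" by (simp add: \<Phi>_def)
  have \<Phi>_Suc: "\<Phi> (Suc n) x = sinkhorn \<beta> (\<Phi> n) x - sinkhorn \<beta> (\<Phi> n) x0" for n x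
    by (simp add: \<Phi>_def)
  have \<Phi>_x0: "\<Phi> n x0 = 0" for n by (cases n) (simp_all add: \<Phi>_0 \<Phi>_Suc)
  have cont: "continuous_on UNIV (\<Phi> n)" for n
  proof (induction n)
    case (Suc n)
    then show ?case
      unfolding \<Phi>_Suc[abs_def] by (intro continuous_intros continuous_sinkhorn assms)
  qed (simp add: \<Phi>_0)
  obtain E where E: "exp_osc_le (\<Phi> (Suc 0)) (\<Phi> 0) E"
    using X.exp_osc_le_exists[OF cont cont] by blast
  have osc: "exp_osc_le (\<Phi> (Suc n)) (\<Phi> n) (q ^ n * E)" for n
  proof (induction n)
    case (Suc n)
    have "(\<Phi> (Suc (Suc n)) x - \<Phi> (Suc n) x) - (\<Phi> (Suc (Suc n)) x' - \<Phi> (Suc n) x')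
      = (sinkhorn \<beta> (\<Phi> (Suc n)) x - sinkhorn \<beta> (\<Phi> n) x)
        - (sinkhorn \<beta> (\<Phi> (Suc n)) x' - sinkhorn \<beta> (\<Phi> n) x')" for x x'
      using \<Phi>_Suc[of n x] \<Phi>_Suc[of n x'] \<Phi>_Suc[of "Suc n" x] \<Phi>_Suc[of "Suc n" x'] by linarith
    then show ?case using q(3)[OF cont cont Suc] by (simp only: exp_osc_le_def power_Suc mult.assoc) blast
  qed (simp add: E)
  have step: "norm (\<Phi> (Suc n) x - \<Phi> n x) \<le> q ^ n * E" for n x
  proof -
    \<comment> \<open>The increment vanishes at \<open>x0\<close>, so its oscillation bounds its size; \<open>1 + t \<le> exp t\<close> does the rest.\<close>
    define t where "t = \<Phi> (Suc n) x - \<Phi> n x"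
    have "exp t \<le> 1 + q ^ n * E" "exp (- t) \<le> 1 + q ^ n * E"
      using osc[of n, unfolded exp_osc_le_def, rule_format, of x x0]
        osc[of n, unfolded exp_osc_le_def, rule_format, of x0 x]
      by (simp_all add: \<Phi>_x0 t_def)
    then have "\<bar>t\<bar> \<le> q ^ n * E"
      using exp_ge_add_one_self[of t] exp_ge_add_one_self[of "- t"] by linarith
    then show ?thesis by (simp add: t_def)
  qed
  define \<phi> where "\<phi> x = (\<Sum>i. \<Phi> (Suc i) x - \<Phi> i x)" for x
  have "uniform_limit UNIV (\<lambda>n x. \<Sum>i<n. \<Phi> (Suc i) x - \<Phi> i x) \<phi> sequentially"
    unfolding \<phi>_def
    by (rule Weierstrass_m_test[where M = "\<lambda>n. q ^ n * E"])
      (use step q in \<open>auto intro!: summable_mult2 summable_geometric\<close>)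
  moreover have "(\<Sum>i<n. \<Phi> (Suc i) x - \<Phi> i x) = \<Phi> n x" for n x
    using sum_lessThan_telescope[of "\<lambda>i. \<Phi> i x" n] by (simp add: \<Phi>_0)
  ultimately have lim: "uniform_limit UNIV \<Phi> \<phi> sequentially"
    by (simp only:)
  then have cont_\<phi>: "continuous_on UNIV \<phi>"
    by (intro uniform_limit_theorem[OF _ lim]) (auto simp: cont)
  have lim_sinkhorn: "(\<lambda>n. sinkhorn \<beta> (\<Phi> n) x) \<longlonglongrightarrow> sinkhorn \<beta> \<phi> x" for x
  proof (rule tendstoI)
    fix e :: real assume "e > 0"
    then have "\<forall>\<^sub>F n in sequentially. \<forall>x\<in>UNIV. dist (\<Phi> n x) (\<phi> x) < e / 2"
      by (intro uniform_limitD[OF lim]) simp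
    then show "\<forall>\<^sub>F n in sequentially. dist (sinkhorn \<beta> (\<Phi> n) x) (sinkhorn \<beta> \<phi> x) < e"
    proof eventually_elim
      case (elim n)
      then have "\<bar>sinkhorn \<beta> (\<Phi> n) x - sinkhorn \<beta> \<phi> x\<bar> \<le> e / 2"
        by (intro sinkhorn_nonexpansive assms cont cont_\<phi>) (auto simp: dist_real_def intro: less_imp_le)
      with \<open>e > 0\<close> show ?case by (simp add: dist_real_def)
    qed
  qed
  define l where "l = sinkhorn \<beta> \<phi> x0"
  define \<psi> where "\<psi> = y_transform \<beta> \<phi>"
  have \<phi>_eq: "\<phi> x = sinkhorn \<beta> \<phi> x - l" for x
  proof (rule LIMSEQ_unique)
    show "(\<lambda>n. \<Phi> (Suc n) x) \<longlonglongrightarrow> \<phi> x"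
      using LIMSEQ_Suc[OF tendsto_uniform_limitI[OF lim, of x]] by simp
    show "(\<lambda>n. \<Phi> (Suc n) x) \<longlonglongrightarrow> sinkhorn \<beta> \<phi> x - l"
      unfolding \<Phi>_Suc l_def by (intro tendsto_diff lim_sinkhorn)
  qed
  have cont_\<psi>: "continuous_on UNIV \<psi>"
    unfolding \<psi>_def by (intro continuous_transforms assms cont_\<phi>)
  have int_\<mu>: "(\<integral>x. exp (\<beta> * A (x, y) + \<phi> x + \<psi> y) \<partial>\<mu>) = 1" for y
    using X.integral_exp_eq_1_iff_soft_transform[of "\<lambda>x y. \<beta> * A (x, y)" y \<phi> "\<psi> y"] cont_\<phi>
    by (simp add: continuous_intros \<psi>_def)
  have int_\<nu>: "(\<integral>y. exp (\<beta> * A (x, y) + \<phi> x + \<psi> y) \<partial>\<nu>) = exp (- l)" for x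
  proof -
    have "(\<integral>y. exp (\<beta> * A (x, y) + \<psi> y + sinkhorn \<beta> \<phi> x) \<partial>\<nu>) = 1"
      using Y.integral_exp_eq_1_iff_soft_transform[of "\<lambda>y x. \<beta> * A (x, y)" x \<psi> "sinkhorn \<beta> \<phi> x"] cont_\<psi>
      by (simp add: continuous_intros sinkhorn_def \<psi>_def)
    then have "(\<integral>y. exp (- l) * exp (\<beta> * A (x, y) + \<psi> y + sinkhorn \<beta> \<phi> x) \<partial>\<nu>) = exp (- l)"
      by simp
    then show ?thesis
      by (simp add: mult_exp_exp \<phi>_eq[of x] algebra_simps)
  qed
  have "integrable (\<mu> \<Otimes>\<^sub>M \<nu>) (\<lambda>(x, y). exp (\<beta> * A (x, y) + \<phi> x + \<psi> y))"
    unfolding split_beta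
    by (intro P.integrable_continuous continuous_intros
        continuous_on_compose2[OF cont_\<phi>] continuous_on_compose2[OF cont_\<psi>]) auto
  from Fubini_integral[OF this] have "1 = exp (- l)"
    by (simp add: int_\<mu> int_\<nu>)
  then have "l = 0" by simp
  with int_\<mu> int_\<nu> cont_\<phi> cont_\<psi> show ?thesis
    unfolding normalizing_pair_def by auto
qed

end

section \<open>Relative entropy\<close>

lemma D_KL_eq_integral:
  assumes "absolutely_continuous \<rho> \<eta>"
    and int: "integrable \<eta> (\<lambda>z. ln (enn2real (RN_deriv \<rho> \<eta> z)))"
  shows "D_KL \<eta> \<rho> = ereal (\<integral>z. ln (enn2real (RN_deriv \<rho> \<eta> z)) \<partial>\<eta>)"
proof -
  define l where "l z = ln (enn2real (RN_deriv \<rho> \<eta> z))" for z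
  have l: "integrable \<eta> l" using int unfolding l_def .
  have fin: "(\<integral>\<^sup>+z. ennreal (l z) \<partial>\<eta>) \<noteq> \<infinity>" "(\<integral>\<^sup>+z. ennreal (- l z) \<partial>\<eta>) \<noteq> \<infinity>"
    using l unfolding real_integrable_def by auto
  have "ereal (\<integral>z. l z \<partial>\<eta>) = enn2ereal (\<integral>\<^sup>+z. ennreal (l z) \<partial>\<eta>) - enn2ereal (\<integral>\<^sup>+z. ennreal (- l z) \<partial>\<eta>)"
    using fin by (cases "\<integral>\<^sup>+z. ennreal (l z) \<partial>\<eta>"; cases "\<integral>\<^sup>+z. ennreal (- l z) \<partial>\<eta>")
      (simp_all add: real_lebesgue_integral_def[OF l] enn2ereal_ennreal)
  then show ?thesis using assms(1) by (simp add: D_KL_def l_def)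
qed

lemma D_KL_density_exp:
  assumes \<rho>: "sigma_finite_measure \<rho>" and [measurable]: "g \<in> borel_measurable \<rho>"
    and int: "integrable (density \<rho> (\<lambda>z. ennreal (exp (g z)))) g"
  defines "\<eta> \<equiv> density \<rho> (\<lambda>z. ennreal (exp (g z)))"
  shows "D_KL \<eta> \<rho> = ereal (\<integral>z. g z \<partial>\<eta>)"
proof -
  interpret sigma_finite_measure \<rho> by fact
  have ac: "absolutely_continuous \<rho> \<eta>"
    unfolding \<eta>_def by (intro absolutely_continuousI_density) measurable
  have [measurable_cong, simp]: "sets \<eta> = sets \<rho>" by (simp add: \<eta>_def)
  have "AE z in \<rho>. ennreal (exp (g z)) = RN_deriv \<rho> \<eta> z"
    unfolding \<eta>_def by (rule RN_deriv_unique) auto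
  then have "AE z in \<eta>. ennreal (exp (g z)) = RN_deriv \<rho> \<eta> z"
    by (rule absolutely_continuous_AE[OF _ ac, rotated]) simp
  then have ae: "AE z in \<eta>. g z = ln (enn2real (RN_deriv \<rho> \<eta> z))"
  proof eventually_elim
    case (elim z)
    show ?case unfolding elim[symmetric] by simp
  qed
  have m: "(\<lambda>z. ln (enn2real (RN_deriv \<rho> \<eta> z))) \<in> borel_measurable \<eta>" by measurable
  have mg: "g \<in> borel_measurable \<eta>" by measurable
  have "integrable \<eta> (\<lambda>z. ln (enn2real (RN_deriv \<rho> \<eta> z)))"
    using int integrable_cong_AE[OF mg m ae] by (simp add: \<eta>_def)
  moreover have "(\<integral>z. g z \<partial>\<eta>) = (\<integral>z. ln (enn2real (RN_deriv \<rho> \<eta> z)) \<partial>\<eta>)"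
    by (rule integral_cong_AE[OF mg m ae])
  ultimately show ?thesis using D_KL_eq_integral[OF ac] by simp
qed

text \<open>
  With \<open>r = d\<eta> / d\<rho>\<close> and \<open>w = exp g / r\<close>, one has \<open>g - ln r = ln w \<le> w - 1\<close> almost everywhere for \<open>\<eta>\<close>, and
  \<open>\<integral> w d\<eta> \<le> \<integral> exp g d\<rho> \<le> 1\<close>.  The same pointwise inequality bounds the negative part of \<open>ln r\<close>, so the
  relative entropy is either an ordinary integral or \<open>\<infinity>\<close>.
\<close>

lemma D_KL_ge_integral:
  assumes \<rho>: "sigma_finite_measure \<rho>" and \<eta>: "prob_space \<eta>" and sets: "sets \<eta> = sets \<rho>"
    and [measurable]: "g \<in> borel_measurable \<rho>" and bound: "\<And>z. \<bar>g z\<bar> \<le> K"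
    and mass: "(\<integral>\<^sup>+z. ennreal (exp (g z)) \<partial>\<rho>) \<le> 1"
  shows "ereal (\<integral>z. g z \<partial>\<eta>) \<le> D_KL \<eta> \<rho>"
proof (cases "absolutely_continuous \<rho> \<eta>")
  case ac: True
  interpret \<rho>: sigma_finite_measure \<rho> by fact
  interpret \<eta>: prob_space \<eta> by fact
  note [measurable_cong, simp] = sets
  define f where "f = RN_deriv \<rho> \<eta>"
  have [measurable]: "f \<in> borel_measurable \<rho>" by (simp add: f_def)
  have \<eta>_eq: "\<eta> = density \<rho> f"
    unfolding f_def by (rule \<rho>.density_RN_deriv[OF ac sets, symmetric])
  define r where "r z = enn2real (f z)" for z
  have [measurable]: "r \<in> borel_measurable \<rho>" unfolding r_def by measurable
  have fin: "AE z in \<rho>. f z \<noteq> \<infinity>"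
    unfolding f_def by (intro \<rho>.RN_deriv_finite ac sets) unfold_locales
  have "AE z in \<eta>. f z \<noteq> \<infinity>"
    by (rule absolutely_continuous_AE[OF _ ac fin]) simp
  moreover have "AE z in \<eta>. f z \<noteq> 0"
    unfolding \<eta>_eq by (subst AE_density) auto
  ultimately have rpos: "AE z in \<eta>. r z > 0"
    by eventually_elim (simp add: r_def enn2real_positive_iff less_top[symmetric] zero_less_iff_neq_zero)
  define w where "w z = exp (g z) / r z" for z
  have [measurable]: "w \<in> borel_measurable \<rho>" unfolding w_def by measurable
  have w_nonneg: "w z \<ge> 0" for z by (simp add: w_def r_def)
  have "(\<integral>\<^sup>+z. ennreal (w z) \<partial>\<eta>) = (\<integral>\<^sup>+z. f z * ennreal (w z) \<partial>\<rho>)"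
    unfolding \<eta>_eq by (rule nn_integral_density) measurable
  also have "\<dots> \<le> (\<integral>\<^sup>+z. ennreal (exp (g z)) \<partial>\<rho>)"
  proof (rule nn_integral_mono_AE)
    show "AE z in \<rho>. f z * ennreal (w z) \<le> ennreal (exp (g z))"
      using fin
    proof eventually_elim
      case (elim z)
      then have "f z = ennreal (r z)" by (simp add: r_def less_top)
      then have "f z * ennreal (w z) = ennreal (r z * w z)"
        by (simp add: ennreal_mult r_def w_nonneg)
      also have "\<dots> \<le> ennreal (exp (g z))"
        by (rule ennreal_leI) (simp add: w_def)
      finally show ?case .
    qed
  qed
  finally have w_mass: "(\<integral>\<^sup>+z. ennreal (w z) \<partial>\<eta>) \<le> 1" using mass by simp
  then have w_int: "integrable \<eta> w"
    by (intro integrableI_nonneg) (auto simp: w_nonneg intro: le_less_trans)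
  have "ennreal (\<integral>z. w z \<partial>\<eta>) \<le> 1"
    using w_mass w_int by (simp add: nn_integral_eq_integral w_nonneg)
  then have w_le: "(\<integral>z. w z \<partial>\<eta>) \<le> 1" by simp
  have g_int: "integrable \<eta> g"
    by (rule \<eta>.integrable_const_bound[of _ K]) (auto simp: bound)
  have key: "AE z in \<eta>. g z - ln (r z) \<le> w z - 1"
    using rpos
  proof eventually_elim
    case (elim z)
    then have "g z - ln (r z) = ln (w z)" by (simp add: w_def ln_div)
    also have "\<dots> \<le> w z - 1" using elim by (intro ln_le_minus_one) (simp add: w_def)
    finally show ?case .
  qed
  have "(\<integral>\<^sup>+z. ennreal (- ln (r z)) \<partial>\<eta>) \<le> (\<integral>\<^sup>+z. ennreal (w z - 1 - g z) + ennreal 0 \<partial>\<eta>)"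
    by (rule nn_integral_mono_AE) (use key in \<open>eventually_elim; simp add: ennreal_leI\<close>)
  also have "\<dots> < \<infinity>"
  proof -
    have "integrable \<eta> (\<lambda>z. w z - 1 - g z)"
      using w_int g_int by simp
    then show ?thesis by (simp add: real_integrable_def less_top[symmetric])
  qed
  finally have neg: "(\<integral>\<^sup>+z. ennreal (- ln (r z)) \<partial>\<eta>) < \<infinity>" .
  show ?thesis
  proof (cases "(\<integral>\<^sup>+z. ennreal (ln (r z)) \<partial>\<eta>) = \<infinity>")
    case True
    have "D_KL \<eta> \<rho> = \<infinity>"
      using ac True neg by (cases "\<integral>\<^sup>+z. ennreal (- ln (r z)) \<partial>\<eta>")
        (auto simp: D_KL_def r_def f_def enn2ereal_ennreal)
    then show ?thesis by simp
  next
    case False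
    have ln_int: "integrable \<eta> (\<lambda>z. ln (r z))"
      unfolding real_integrable_def using False neg by auto
    have "(\<integral>z. g z - ln (r z) \<partial>\<eta>) \<le> (\<integral>z. w z - 1 \<partial>\<eta>)"
      by (rule integral_mono_AE) (auto intro: g_int ln_int w_int key)
    also have "\<dots> \<le> 0" using w_le w_int by (simp add: \<eta>.prob_space)
    finally have "(\<integral>z. g z \<partial>\<eta>) \<le> (\<integral>z. ln (r z) \<partial>\<eta>)"
      using g_int ln_int by simp
    then show ?thesis
      using D_KL_eq_integral[OF ac] ln_int by (simp add: r_def f_def)
  qed
qed (simp add: D_KL_def)

section \<open>Gibbs plans and the pressure\<close>

context lipschitz_transport
begin

lemma plan_compact_borel_prob:
  "\<pi> \<in> borel_probs \<Longrightarrow> compact_borel_prob (\<pi> :: ('a \<times> 'b) measure)"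
  using P.compact_UNIV by unfold_locales

lemma integral_marginals:
  assumes \<pi>: "\<pi> \<in> transference_plans \<mu> \<nu>"
  shows "continuous_on UNIV f \<Longrightarrow> (\<integral>z. f (fst z) \<partial>\<pi>) = (\<integral>x. f x \<partial>\<mu> :: real)"
    and "continuous_on UNIV g \<Longrightarrow> (\<integral>z. g (snd z) \<partial>\<pi>) = (\<integral>y. g y \<partial>\<nu> :: real)"
proof -
  interpret \<pi>: compact_borel_prob \<pi>
    using \<pi> by (intro plan_compact_borel_prob) (simp add: transference_plans_def)
  have m: "fst \<in> measurable \<pi> borel" "snd \<in> measurable \<pi> borel"
    by (intro \<pi>.measurable_continuous continuous_intros)+
  have d: "distr \<pi> borel fst = \<mu>" "distr \<pi> borel snd = \<nu>"
    using \<pi> by (auto simp: transference_plans_def)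
  show "continuous_on UNIV f \<Longrightarrow> (\<integral>z. f (fst z) \<partial>\<pi>) = (\<integral>x. f x \<partial>\<mu> :: real)"
    using integral_distr[OF m(1), of f] by (simp add: d borel_measurable_continuous_onI)
  show "continuous_on UNIV g \<Longrightarrow> (\<integral>z. g (snd z) \<partial>\<pi>) = (\<integral>y. g y \<partial>\<nu> :: real)"
    using integral_distr[OF m(2), of g] by (simp add: d borel_measurable_continuous_onI)
qed

text \<open>
  Testing marginals against continuous functions only makes the plan property stable under weak*
  limits, and reduces it to Fubini for Gibbs plans.
\<close>

lemma transference_planI:
  assumes \<pi>: "\<pi> \<in> borel_probs"
    and X: "\<And>f :: 'a \<Rightarrow> real. continuous_on UNIV f \<Longrightarrow> (\<integral>z. f (fst z) \<partial>\<pi>) = (\<integral>x. f x \<partial>\<mu>)"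
    and Y: "\<And>g :: 'b \<Rightarrow> real. continuous_on UNIV g \<Longrightarrow> (\<integral>z. g (snd z) \<partial>\<pi>) = (\<integral>y. g y \<partial>\<nu>)"
  shows "\<pi> \<in> transference_plans \<mu> \<nu>"
proof -
  interpret \<pi>: compact_borel_prob \<pi> using \<pi> by (rule plan_compact_borel_prob)
  have m: "fst \<in> measurable \<pi> borel" "snd \<in> measurable \<pi> borel"
    by (intro \<pi>.measurable_continuous continuous_intros)+
  have "\<mu> = distr \<pi> borel fst"
  proof (rule X.eq_if_continuous_integrals_eq)
    show "distr \<pi> borel fst \<in> borel_probs"
      using \<pi>.prob_space_distr[OF m(1)] by (simp add: borel_probs_def)
    fix f :: "'a \<Rightarrow> real" assume f: "continuous_on UNIV f"
    show "X.expectation f = (\<integral>x. f x \<partial>distr \<pi> borel fst)"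
      using integral_distr[OF m(1) borel_measurable_continuous_onI[OF f]] X[OF f] by simp
  qed
  moreover have "\<nu> = distr \<pi> borel snd"
  proof (rule Y.eq_if_continuous_integrals_eq)
    show "distr \<pi> borel snd \<in> borel_probs"
      using \<pi>.prob_space_distr[OF m(2)] by (simp add: borel_probs_def)
    fix f :: "'b \<Rightarrow> real" assume f: "continuous_on UNIV f"
    show "Y.expectation f = (\<integral>x. f x \<partial>distr \<pi> borel snd)"
      using integral_distr[OF m(2) borel_measurable_continuous_onI[OF f]] Y[OF f] by simp
  qed
  ultimately show ?thesis using \<pi> by (simp add: transference_plans_def)
qed

definition gibbs_exponent :: "real \<Rightarrow> ('a \<Rightarrow> real) \<Rightarrow> ('b \<Rightarrow> real) \<Rightarrow> 'a \<times> 'b \<Rightarrow> real" where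
  "gibbs_exponent \<beta> \<phi> \<psi> z = \<beta> * A z + \<phi> (fst z) + \<psi> (snd z)"

lemma gibbs_plan_eq_density:
  "gibbs_plan \<mu> \<nu> A \<beta> \<phi> \<psi> = density (\<mu> \<Otimes>\<^sub>M \<nu>) (\<lambda>z. ennreal (exp (gibbs_exponent \<beta> \<phi> \<psi> z)))"
  by (simp add: gibbs_plan_def gibbs_exponent_def case_prod_beta')

lemma continuous_fst_comp:
  "continuous_on UNIV f \<Longrightarrow> continuous_on UNIV (\<lambda>z :: 'a \<times> 'b. f (fst z) :: real)"
  by (rule continuous_on_compose2[of UNIV f]) (auto intro: continuous_intros)

lemma continuous_snd_comp:
  "continuous_on UNIV f \<Longrightarrow> continuous_on UNIV (\<lambda>z :: 'a \<times> 'b. f (snd z) :: real)"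
  by (rule continuous_on_compose2[of UNIV f]) (auto intro: continuous_intros)

context
  fixes \<beta> \<phi> \<psi>
  assumes normalizing: "normalizing_pair \<mu> \<nu> A \<beta> \<phi> \<psi>"
begin

private abbreviation g where "g \<equiv> gibbs_exponent \<beta> \<phi> \<psi>"
private abbreviation G where "G \<equiv> gibbs_plan \<mu> \<nu> A \<beta> \<phi> \<psi>"

lemma continuous_potentials: "continuous_on UNIV \<phi>" "continuous_on UNIV \<psi>"
  using normalizing by (auto simp: normalizing_pair_def)

lemma continuous_gibbs_exponent: "continuous_on UNIV (gibbs_exponent \<beta> \<phi> \<psi>)"
  unfolding gibbs_exponent_def[abs_def]
  by (intro continuous_intros continuous_A continuous_fst_comp continuous_snd_comp continuous_potentials)

lemma integral_gibbs_plan: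
  assumes "continuous_on UNIV f"
  shows "(\<integral>z. f z \<partial>gibbs_plan \<mu> \<nu> A \<beta> \<phi> \<psi>) = (\<integral>z. exp (g z) * f z \<partial>(\<mu> \<Otimes>\<^sub>M \<nu>))"
proof -
  have "f \<in> borel_measurable (\<mu> \<Otimes>\<^sub>M \<nu>)" "(\<lambda>z. exp (g z)) \<in> borel_measurable (\<mu> \<Otimes>\<^sub>M \<nu>)"
    by (intro P.measurable_continuous continuous_intros assms continuous_gibbs_exponent)+
  then show ?thesis
    unfolding gibbs_plan_eq_density by (subst integral_density) auto
qed

lemma gibbs_plan_marginals:
  fixes f :: "'a \<Rightarrow> real" and h :: "'b \<Rightarrow> real"
  shows "continuous_on UNIV f \<Longrightarrow> (\<integral>z. f (fst z) \<partial>gibbs_plan \<mu> \<nu> A \<beta> \<phi> \<psi>) = (\<integral>x. f x \<partial>\<mu>)"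
    and "continuous_on UNIV h \<Longrightarrow> (\<integral>z. h (snd z) \<partial>gibbs_plan \<mu> \<nu> A \<beta> \<phi> \<psi>) = (\<integral>y. h y \<partial>\<nu>)"
proof -
  have int: "integrable (\<mu> \<Otimes>\<^sub>M \<nu>) (\<lambda>(x, y). exp (g (x, y)) * k (x, y))" if "continuous_on UNIV k" for k
    using P.integrable_continuous[of "\<lambda>z. exp (g z) * k z"] continuous_gibbs_exponent that
    by (simp add: case_prod_beta' continuous_intros)
  have n: "(\<integral>y. exp (g (x, y)) \<partial>\<nu>) = 1" "(\<integral>x. exp (g (x, y)) \<partial>\<mu>) = 1" for x y
    using normalizing by (auto simp: normalizing_pair_def gibbs_exponent_def)
  {
    assume f: "continuous_on UNIV f"
    have "(\<integral>z. f (fst z) \<partial>G) = (\<integral>x. (\<integral>y. exp (g (x, y)) * f x \<partial>\<nu>) \<partial>\<mu>)"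
      using integral_fst'[OF int[OF continuous_fst_comp[OF f]]]
        integral_gibbs_plan[OF continuous_fst_comp[OF f]] by (simp add: case_prod_beta')
    also have "\<dots> = (\<integral>x. f x \<partial>\<mu>)" by (simp add: n)
    finally show "(\<integral>z. f (fst z) \<partial>G) = (\<integral>x. f x \<partial>\<mu>)" .
  }
  {
    assume h: "continuous_on UNIV h"
    have "(\<integral>z. h (snd z) \<partial>G) = (\<integral>y. (\<integral>x. exp (g (x, y)) * h y \<partial>\<mu>) \<partial>\<nu>)"
      using integral_snd[OF int[OF continuous_snd_comp[OF h]]]
        integral_gibbs_plan[OF continuous_snd_comp[OF h]] by (simp add: case_prod_beta')
    also have "\<dots> = (\<integral>y. h y \<partial>\<nu>)" by (simp add: n)
    finally show "(\<integral>z. h (snd z) \<partial>G) = (\<integral>y. h y \<partial>\<nu>)" .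
  }
qed

lemma nn_integral_exp_gibbs_exponent:
  "(\<integral>\<^sup>+z. ennreal (exp (gibbs_exponent \<beta> \<phi> \<psi> z)) \<partial>(\<mu> \<Otimes>\<^sub>M \<nu>)) = 1"
proof -
  have "(\<integral>\<^sup>+z. ennreal (exp (g z)) \<partial>(\<mu> \<Otimes>\<^sub>M \<nu>)) = ennreal (\<integral>z. exp (g z) \<partial>(\<mu> \<Otimes>\<^sub>M \<nu>))"
    by (intro nn_integral_eq_integral P.integrable_continuous continuous_intros
        continuous_gibbs_exponent) auto
  also have "(\<integral>z. exp (g z) \<partial>(\<mu> \<Otimes>\<^sub>M \<nu>)) = (\<integral>x. 1 \<partial>\<mu>)"
    using trans[OF integral_gibbs_plan[of "\<lambda>_. 1", symmetric] gibbs_plan_marginals(1)[of "\<lambda>_. 1"]]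
    by (simp only: continuous_on_const mult_1_right)
  finally show ?thesis by simp
qed

lemma gibbs_plan_borel_prob: "gibbs_plan \<mu> \<nu> A \<beta> \<phi> \<psi> \<in> borel_probs"
proof -
  have m: "(\<lambda>z. ennreal (exp (g z))) \<in> borel_measurable (\<mu> \<Otimes>\<^sub>M \<nu>)"
    by (intro measurable_compose[OF P.measurable_continuous measurable_ennreal] continuous_intros
        continuous_gibbs_exponent)
  have "emeasure G (space (\<mu> \<Otimes>\<^sub>M \<nu>))
      = (\<integral>\<^sup>+z. ennreal (exp (g z)) * indicator (space (\<mu> \<Otimes>\<^sub>M \<nu>)) z \<partial>(\<mu> \<Otimes>\<^sub>M \<nu>))"
    unfolding gibbs_plan_eq_density by (rule emeasure_density[OF m sets.top])
  also have "\<dots> = (\<integral>\<^sup>+z. ennreal (exp (g z)) \<partial>(\<mu> \<Otimes>\<^sub>M \<nu>))"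
    by (rule nn_integral_cong) simp
  also have "\<dots> = 1" by (rule nn_integral_exp_gibbs_exponent)
  finally have "prob_space G"
    by (intro prob_spaceI) (simp only: gibbs_plan_eq_density space_density)
  moreover have "sets G = sets borel"
    unfolding gibbs_plan_eq_density sets_density by (rule P.sets_M)
  ultimately show ?thesis by (simp only: borel_probs_def mem_Collect_eq)
qed

lemma gibbs_plan_transference_plan: "gibbs_plan \<mu> \<nu> A \<beta> \<phi> \<psi> \<in> transference_plans \<mu> \<nu>"
  by (intro transference_planI gibbs_plan_borel_prob gibbs_plan_marginals)

text \<open>
  The potentials enter only through the marginals, so their contribution is the same for all plans.
  This is why maximizing energy plus entropy amounts to comparing a plan with the Gibbs plan.
\<close>

lemma integral_gibbs_exponent:
  assumes "\<pi> \<in> transference_plans \<mu> \<nu>"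
  shows "(\<integral>z. gibbs_exponent \<beta> \<phi> \<psi> z \<partial>\<pi>) = (\<integral>z. \<beta> * A z \<partial>\<pi>) + (\<integral>x. \<phi> x \<partial>\<mu>) + (\<integral>y. \<psi> y \<partial>\<nu>)"
proof -
  interpret \<pi>: compact_borel_prob \<pi>
    using assms by (intro plan_compact_borel_prob) (simp add: transference_plans_def)
  have "integrable \<pi> (\<lambda>z. \<beta> * A z)" "integrable \<pi> (\<lambda>z. \<phi> (fst z))" "integrable \<pi> (\<lambda>z. \<psi> (snd z))"
    by (intro \<pi>.integrable_continuous continuous_intros continuous_A continuous_fst_comp
        continuous_snd_comp continuous_potentials)+
  then show ?thesis
    unfolding gibbs_exponent_def
    by (simp add: integral_marginals[OF assms] continuous_potentials del: integral_mult_right_zero)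
qed

lemma D_KL_gibbs_plan:
  "D_KL (gibbs_plan \<mu> \<nu> A \<beta> \<phi> \<psi>) (\<mu> \<Otimes>\<^sub>M \<nu>)
     = ereal ((\<integral>z. \<beta> * A z \<partial>gibbs_plan \<mu> \<nu> A \<beta> \<phi> \<psi>) + (\<integral>x. \<phi> x \<partial>\<mu>) + (\<integral>y. \<psi> y \<partial>\<nu>))"
proof -
  interpret G: compact_borel_prob G
    by (intro plan_compact_borel_prob gibbs_plan_borel_prob)
  have "integrable G g"
    by (intro G.integrable_continuous continuous_gibbs_exponent)
  then have "D_KL G (\<mu> \<Otimes>\<^sub>M \<nu>) = ereal (\<integral>z. g z \<partial>G)"
    unfolding gibbs_plan_eq_density
    by (intro D_KL_density_exp P.measurable_continuous continuous_gibbs_exponent) unfold_locales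
  then show ?thesis
    by (simp only: integral_gibbs_exponent[OF gibbs_plan_transference_plan])
qed

lemma transference_plan_D_KL_ge:
  assumes "\<pi> \<in> transference_plans \<mu> \<nu>"
  shows "ereal ((\<integral>z. \<beta> * A z \<partial>\<pi>) + (\<integral>x. \<phi> x \<partial>\<mu>) + (\<integral>y. \<psi> y \<partial>\<nu>)) \<le> D_KL \<pi> (\<mu> \<Otimes>\<^sub>M \<nu>)"
proof -
  interpret \<pi>: compact_borel_prob \<pi>
    using assms by (intro plan_compact_borel_prob) (simp add: transference_plans_def)
  obtain K where K: "\<And>z. \<bar>g z\<bar> \<le> K"
    using P.continuous_bounded[OF continuous_gibbs_exponent] by blast
  have "ereal (\<integral>z. g z \<partial>\<pi>) \<le> D_KL \<pi> (\<mu> \<Otimes>\<^sub>M \<nu>)"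
  proof (rule D_KL_ge_integral)
    show "sigma_finite_measure (\<mu> \<Otimes>\<^sub>M \<nu>)" by unfold_locales
    show "sets \<pi> = sets (\<mu> \<Otimes>\<^sub>M \<nu>)" by (simp only: \<pi>.sets_M P.sets_M)
    show "g \<in> borel_measurable (\<mu> \<Otimes>\<^sub>M \<nu>)"
      by (intro P.measurable_continuous continuous_gibbs_exponent)
    show "\<bar>g z\<bar> \<le> K" for z by (rule K)
  qed (simp_all add: nn_integral_exp_gibbs_exponent \<pi>.prob_space_axioms K)
  then show ?thesis by (simp only: integral_gibbs_exponent[OF assms])
qed

theorem pressure_eq:
  "pressure \<mu> \<nu> (\<lambda>z. \<beta> * A z) = ereal (- (\<integral>x. \<phi> x \<partial>\<mu>) - (\<integral>y. \<psi> y \<partial>\<nu>))"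
  "pressure \<mu> \<nu> (\<lambda>z. \<beta> * A z) = ereal (\<integral>z. \<beta> * A z \<partial>gibbs_plan \<mu> \<nu> A \<beta> \<phi> \<psi>)
     + plan_entropy \<mu> \<nu> (gibbs_plan \<mu> \<nu> A \<beta> \<phi> \<psi>)"
proof -
  let ?v = "ereal (- (\<integral>x. \<phi> x \<partial>\<mu>) - (\<integral>y. \<psi> y \<partial>\<nu>))"
  have le: "ereal (\<integral>z. \<beta> * A z \<partial>\<pi>) + plan_entropy \<mu> \<nu> \<pi> \<le> ?v" if "\<pi> \<in> transference_plans \<mu> \<nu>" for \<pi>
    using transference_plan_D_KL_ge[OF that] unfolding plan_entropy_def
    by (cases "D_KL \<pi> (\<mu> \<Otimes>\<^sub>M \<nu>)") auto
  have eq: "ereal (\<integral>z. \<beta> * A z \<partial>G) + plan_entropy \<mu> \<nu> G = ?v"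
    unfolding plan_entropy_def D_KL_gibbs_plan by simp
  show v: "pressure \<mu> \<nu> (\<lambda>z. \<beta> * A z) = ?v"
    unfolding pressure_def
  proof (rule antisym)
    show "(SUP \<pi>\<in>transference_plans \<mu> \<nu>. ereal (\<integral>z. \<beta> * A z \<partial>\<pi>) + plan_entropy \<mu> \<nu> \<pi>) \<le> ?v"
      by (rule SUP_least) (rule le)
    show "?v \<le> (SUP \<pi>\<in>transference_plans \<mu> \<nu>. ereal (\<integral>z. \<beta> * A z \<partial>\<pi>) + plan_entropy \<mu> \<nu> \<pi>)"
      unfolding eq[symmetric] by (rule SUP_upper) (rule gibbs_plan_transference_plan)
  qed
  show "pressure \<mu> \<nu> (\<lambda>z. \<beta> * A z) = ereal (\<integral>z. \<beta> * A z \<partial>G) + plan_entropy \<mu> \<nu> G"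
    unfolding v eq ..
qed

text \<open>
  This is the nonnegativity of the relative entropy of the Gibbs plan, the case \<open>g = 0\<close> of
  \<open>D_KL_ge_integral\<close>.
\<close>

lemma gibbs_plan_energy_ge:
  "0 \<le> \<beta> * (\<integral>z. A z \<partial>gibbs_plan \<mu> \<nu> A \<beta> \<phi> \<psi>) + (\<integral>x. \<phi> x \<partial>\<mu>) + (\<integral>y. \<psi> y \<partial>\<nu>)"
proof -
  interpret G: compact_borel_prob G
    by (intro plan_compact_borel_prob gibbs_plan_borel_prob)
  have "ereal (\<integral>z. 0 \<partial>G) \<le> D_KL G (\<mu> \<Otimes>\<^sub>M \<nu>)"
  proof (rule D_KL_ge_integral[of _ _ _ 0])
    show "sets G = sets (\<mu> \<Otimes>\<^sub>M \<nu>)" by (simp only: G.sets_M P.sets_M)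
    show "sigma_finite_measure (\<mu> \<Otimes>\<^sub>M \<nu>)" by unfold_locales
    show "prob_space G" by (rule G.prob_space_axioms)
    show "(\<integral>\<^sup>+z. ennreal (exp 0) \<partial>(\<mu> \<Otimes>\<^sub>M \<nu>)) \<le> 1"
      by (simp add: P.emeasure_space_1[simplified])
  qed auto
  then show ?thesis unfolding D_KL_gibbs_plan by simp
qed

end

end

section \<open>The zero-temperature limit\<close>

context lipschitz_transport
begin

lemma transport_cost_le:
  assumes "\<pi> \<in> transference_plans \<mu> \<nu>"
  shows "transport_cost \<mu> \<nu> (\<lambda>z. - A z) \<le> (\<integral>z. - A z \<partial>\<pi>)"
  unfolding transport_cost_def
proof (rule cINF_lower[OF _ assms])
  obtain K where K: "\<And>z. \<bar>- A z\<bar> \<le> K"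
    using P.continuous_bounded[OF continuous_on_minus[OF continuous_A]] by blast
  have "- K \<le> (\<integral>z. - A z \<partial>\<pi>)" if "\<pi> \<in> transference_plans \<mu> \<nu>" for \<pi>
  proof -
    interpret \<pi>: compact_borel_prob \<pi>
      using that by (intro plan_compact_borel_prob) (simp add: transference_plans_def)
    have "\<bar>\<integral>z. - A z \<partial>\<pi>\<bar> \<le> K"
      by (intro \<pi>.abs_integral_le continuous_intros continuous_A K)
    then show ?thesis by linarith
  qed
  then show "bdd_below ((\<lambda>\<pi>. \<integral>z. - A z \<partial>\<pi>) ` transference_plans \<mu> \<nu>)"
    by (intro bdd_belowI2)
qed

lemma approximate_weak_duality:
  assumes cont: "continuous_on UNIV \<phi>" "continuous_on UNIV \<psi>"
    and le: "\<And>x y. \<phi> x + \<psi> y \<le> - A (x, y) + \<epsilon>"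
    and plans: "transference_plans \<mu> \<nu> \<noteq> {}"
  shows "(\<integral>x. \<phi> x \<partial>\<mu>) + (\<integral>y. \<psi> y \<partial>\<nu>) \<le> transport_cost \<mu> \<nu> (\<lambda>z. - A z) + \<epsilon>"
proof -
  have "(\<integral>x. \<phi> x \<partial>\<mu>) + (\<integral>y. \<psi> y \<partial>\<nu>) - \<epsilon> \<le> (\<integral>z. - A z \<partial>\<pi>)" if \<pi>: "\<pi> \<in> transference_plans \<mu> \<nu>" for \<pi>
  proof -
    interpret \<pi>: compact_borel_prob \<pi>
      using that by (intro plan_compact_borel_prob) (simp add: transference_plans_def)
    have int: "integrable \<pi> (\<lambda>z. \<phi> (fst z))" "integrable \<pi> (\<lambda>z. \<psi> (snd z))" "integrable \<pi> A"
      by (intro \<pi>.integrable_continuous continuous_A continuous_fst_comp continuous_snd_comp cont)+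
    have "(\<integral>x. \<phi> x \<partial>\<mu>) + (\<integral>y. \<psi> y \<partial>\<nu>) = (\<integral>z. \<phi> (fst z) + \<psi> (snd z) \<partial>\<pi>)"
      using int by (simp add: integral_marginals[OF \<pi>] cont)
    also have "\<dots> \<le> (\<integral>z. - A z + \<epsilon> \<partial>\<pi>)"
      by (intro \<pi>.integral_continuous_mono continuous_intros continuous_A continuous_fst_comp
          continuous_snd_comp cont) (use le in \<open>auto simp: split_paired_all\<close>)
    also have "\<dots> = (\<integral>z. - A z \<partial>\<pi>) + \<epsilon>" using int by simp
    finally show ?thesis by simp
  qed
  then have "(\<integral>x. \<phi> x \<partial>\<mu>) + (\<integral>y. \<psi> y \<partial>\<nu>) - \<epsilon> \<le> transport_cost \<mu> \<nu> (\<lambda>z. - A z)"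
    unfolding transport_cost_def by (intro cINF_greatest plans)
  then show ?thesis by simp
qed

text \<open>
  If \<open>\<beta> A + \<phi> + \<psi>\<close> takes the value \<open>t\<close> at \<open>(x, y)\<close>, then it is at least \<open>s = t - 2 \<beta> L r\<close> at \<open>(x', y)\<close> for
  every \<open>x'\<close> within distance \<open>r\<close> of \<open>x\<close>: one \<open>\<beta> L r\<close> is lost to \<open>\<beta> A\<close> and one to \<open>\<phi>\<close>.
  Integrating the exponential over this ball, of mass at least \<open>m\<close>, gives \<open>m exp s \<le> 1\<close>, hence
  \<open>t / \<beta> \<le> 2 L r - ln m / \<beta>\<close>.  Both terms are made at most \<open>\<epsilon> / 2\<close>, first by the choice of \<open>r\<close> and then by
  that of \<open>\<beta>\<close>.
\<close>

lemma approximate_feasibility: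
  assumes supp: "msupport \<mu> = UNIV" and "\<epsilon> > 0"
  obtains B where "\<And>\<beta> \<phi> \<psi> x y. \<beta> > 0 \<Longrightarrow> \<beta> \<ge> B \<Longrightarrow> normalizing_pair \<mu> \<nu> A \<beta> \<phi> \<psi> \<Longrightarrow>
    \<phi> x / \<beta> + \<psi> y / \<beta> \<le> - A (x, y) + \<epsilon>"
proof -
  \<comment> \<open>The summand \<open>1\<close> covers the case \<open>L = 0\<close>.\<close>
  define r where "r = \<epsilon> / (4 * (L + 1))"
  have "r > 0" using \<open>\<epsilon> > 0\<close> L_nonneg by (simp add: r_def)
  have Lr: "2 * L * r \<le> \<epsilon> / 2"
    using \<open>\<epsilon> > 0\<close> L_nonneg by (simp add: r_def field_simps)
  obtain m where m: "m > 0" "\<And>x. m \<le> measure \<mu> (ball x r)"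
    using X.measure_ball_lower_bound[OF supp \<open>r > 0\<close>] by blast
  show ?thesis
  proof (rule that[of "- 2 * ln m / \<epsilon>"])
    fix \<beta> \<phi> \<psi> x y
    assume \<beta>: "\<beta> > 0" "\<beta> \<ge> - 2 * ln m / \<epsilon>" and n: "normalizing_pair \<mu> \<nu> A \<beta> \<phi> \<psi>"
    have cont: "continuous_on UNIV \<phi>" using continuous_potentials[OF n] by simp
    define s where "s = \<beta> * A (x, y) + \<phi> x + \<psi> y - \<beta> * (2 * L * r)"
    have near: "s \<le> \<beta> * A (x', y) + \<phi> x' + \<psi> y" if "x' \<in> ball x r" for x'
    proof -
      have d: "dist x x' \<le> r" using that by simp
      have "L * dist x x' \<le> L * r" using d L_nonneg by (rule mult_left_mono)
      then have "A (x, y) - A (x', y) \<le> L * r"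
        using A_lipschitz[of x y x' y] by simp
      from mult_left_mono[OF this, of \<beta>] have "\<beta> * A (x, y) - \<beta> * A (x', y) \<le> \<beta> * (L * r)"
        using \<beta> by (simp add: algebra_simps)
      moreover have "\<phi> x - \<phi> x' \<le> \<beta> * (L * dist x x')"
        using normalizing_pair_lipschitz(1)[OF \<beta>(1) n]
        by (auto simp: lipschitz_wrt_def mult.assoc intro: abs_le_D1)
      moreover have "\<beta> * (L * dist x x') \<le> \<beta> * (L * r)"
        using \<open>L * dist x x' \<le> L * r\<close> \<beta>(1) by simp
      ultimately show ?thesis by (simp add: s_def algebra_simps)
    qed
    have "m * exp s \<le> measure \<mu> (ball x r) * exp s"
      using m(2) by (intro mult_right_mono) auto
    also have "\<dots> = (\<integral>x'. indicator (ball x r) x' * exp s \<partial>\<mu>)" by simp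
    also have "\<dots> \<le> (\<integral>x'. exp (\<beta> * A (x', y) + \<phi> x' + \<psi> y) \<partial>\<mu>)"
    proof (rule integral_mono)
      show "integrable \<mu> (\<lambda>x'. indicator (ball x r) x' * exp s)"
        by (intro integrable_mult_left integrable_real_indicator) (auto simp: X.emeasure_eq_measure)
      show "integrable \<mu> (\<lambda>x'. exp (\<beta> * A (x', y) + \<phi> x' + \<psi> y))"
        by (intro X.integrable_continuous continuous_intros cont)
      show "indicator (ball x r) x' * exp s \<le> exp (\<beta> * A (x', y) + \<phi> x' + \<psi> y)" for x'
        using near[of x'] by (cases "x' \<in> ball x r") auto
    qed
    also have "\<dots> = 1" using n by (simp add: normalizing_pair_def)
    finally have "exp s \<le> inverse m" using m(1) by (simp add: field_simps)
    then have "s \<le> - ln m"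
      using m(1) by (metis exp_gt_zero ln_exp ln_inverse ln_le_cancel_iff positive_imp_inverse_positive)
    moreover have "- ln m \<le> \<beta> * (\<epsilon> / 2)" using \<beta>(2) \<open>\<epsilon> > 0\<close> by (simp add: field_simps)
    moreover have "\<beta> * (2 * L * r) \<le> \<beta> * (\<epsilon> / 2)" using Lr \<beta>(1) by (intro mult_left_mono) auto
    ultimately have "\<phi> x + \<psi> y \<le> \<beta> * (- A (x, y) + \<epsilon>)"
      by (simp add: s_def algebra_simps)
    then show "\<phi> x / \<beta> + \<psi> y / \<beta> \<le> - A (x, y) + \<epsilon>"
      using \<beta>(1) by (simp add: add_divide_distrib[symmetric] pos_divide_le_eq mult.commute)
  qed
qed

context
  fixes \<phi> \<psi> and b :: "nat \<Rightarrow> real"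
  assumes supp: "msupport \<mu> = UNIV"
    and pairs: "\<And>\<beta>. \<beta> > 0 \<Longrightarrow> normalizing_pair \<mu> \<nu> A \<beta> (\<phi> \<beta>) (\<psi> \<beta>)"
    and b_pos: "\<And>n. b n > 0" and b_lim: "filterlim b at_top sequentially"
begin

private definition dual_value where
  "dual_value n = (\<integral>x. \<phi> (b n) x / b n \<partial>\<mu>) + (\<integral>y. \<psi> (b n) y / b n \<partial>\<nu>)"

private definition plan where "plan n = gibbs_plan \<mu> \<nu> A (b n) (\<phi> (b n)) (\<psi> (b n))"

private lemma plan: "plan n \<in> transference_plans \<mu> \<nu>"
  unfolding plan_def by (intro gibbs_plan_transference_plan pairs b_pos)

private lemma eventually_feasible:
  assumes "\<epsilon> > 0"
  shows "\<forall>\<^sub>F n in sequentially. \<forall>x y. \<phi> (b n) x / b n + \<psi> (b n) y / b n \<le> - A (x, y) + \<epsilon>"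
proof -
  obtain B where B: "\<And>\<beta> \<phi> \<psi> x y. \<beta> > 0 \<Longrightarrow> \<beta> \<ge> B \<Longrightarrow> normalizing_pair \<mu> \<nu> A \<beta> \<phi> \<psi> \<Longrightarrow>
      \<phi> x / \<beta> + \<psi> y / \<beta> \<le> - A (x, y) + \<epsilon>"
    using approximate_feasibility[OF supp assms] by metis
  have "\<forall>\<^sub>F n in sequentially. b n \<ge> B"
    using b_lim by (simp add: filterlim_at_top)
  then show ?thesis
    by eventually_elim (intro allI B b_pos pairs)
qed

private lemma cost_le: "transport_cost \<mu> \<nu> (\<lambda>z. - A z) \<le> (\<integral>z. - A z \<partial>plan n)"
  by (rule transport_cost_le[OF plan])

private lemma energy_le: "(\<integral>z. - A z \<partial>plan n) \<le> dual_value n"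
proof -
  have "0 \<le> b n * (\<integral>z. A z \<partial>plan n) + (\<integral>x. \<phi> (b n) x \<partial>\<mu>) + (\<integral>y. \<psi> (b n) y \<partial>\<nu>)"
    unfolding plan_def by (rule gibbs_plan_energy_ge[OF pairs[OF b_pos]])
  then show ?thesis
    using b_pos[of n] by (simp add: dual_value_def field_simps)
qed

text \<open>
  The value of the scaled potentials lies between \<open>\<alpha>(c)\<close>, since it dominates the cost of the Gibbs plan,
  and \<open>\<alpha>(c) + \<epsilon>\<close>, by weak duality for almost feasible potentials.
\<close>

lemma dual_value_tendsto:
  "(\<lambda>n. (\<integral>x. \<phi> (b n) x / b n \<partial>\<mu>) + (\<integral>y. \<psi> (b n) y / b n \<partial>\<nu>))
     \<longlonglongrightarrow> transport_cost \<mu> \<nu> (\<lambda>z. - A z)"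
proof -
  have "dual_value \<longlonglongrightarrow> transport_cost \<mu> \<nu> (\<lambda>z. - A z)"
  proof (rule tendstoI)
    fix e :: real assume "e > 0"
    then have "\<forall>\<^sub>F n in sequentially. \<forall>x y. \<phi> (b n) x / b n + \<psi> (b n) y / b n \<le> - A (x, y) + e / 2"
      by (intro eventually_feasible) simp
    then show "\<forall>\<^sub>F n in sequentially. dist (dual_value n) (transport_cost \<mu> \<nu> (\<lambda>z. - A z)) < e"
    proof eventually_elim
      case (elim n)
      have c: "continuous_on UNIV (\<lambda>x. \<phi> (b n) x / b n)" "continuous_on UNIV (\<lambda>y. \<psi> (b n) y / b n)"
        using continuous_potentials[OF pairs[OF b_pos[of n]]] b_pos[of n]
        by (auto intro!: continuous_intros)
      have "dual_value n \<le> transport_cost \<mu> \<nu> (\<lambda>z. - A z) + e / 2"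
        unfolding dual_value_def
        using plan by (intro approximate_weak_duality c) (use elim in auto)
      moreover have "transport_cost \<mu> \<nu> (\<lambda>z. - A z) \<le> dual_value n"
        using cost_le energy_le by (rule order_trans)
      ultimately show ?case using \<open>e > 0\<close> by (simp add: dist_real_def)
    qed
  qed
  then show ?thesis by (simp add: dual_value_def[abs_def])
qed

theorem potential_limit_solves_dual:
  assumes "uniform_limit UNIV (\<lambda>n x. \<phi> (b n) x / b n) \<phi>\<^sub>0 sequentially"
    and "uniform_limit UNIV (\<lambda>n y. \<psi> (b n) y / b n) \<psi>\<^sub>0 sequentially"
  shows "(\<phi>\<^sub>0, \<psi>\<^sub>0) \<in> dual_feasible (\<lambda>z. - A z)"
    and "transport_cost \<mu> \<nu> (\<lambda>z. - A z) = (\<integral>x. \<phi>\<^sub>0 x \<partial>\<mu>) + (\<integral>y. \<psi>\<^sub>0 y \<partial>\<nu>)"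
proof -
  have c: "continuous_on UNIV (\<lambda>x. \<phi> (b n) x / b n)" "continuous_on UNIV (\<lambda>y. \<psi> (b n) y / b n)" for n
    using continuous_potentials[OF pairs[OF b_pos[of n]]] b_pos[of n]
    by (auto intro!: continuous_intros)
  have c0: "continuous_on UNIV \<phi>\<^sub>0" "continuous_on UNIV \<psi>\<^sub>0"
    by (rule uniform_limit_theorem[OF _ assms(1)] uniform_limit_theorem[OF _ assms(2)];
        simp add: c)+
  have "\<phi>\<^sub>0 x + \<psi>\<^sub>0 y \<le> - A (x, y)" for x y
  proof (rule field_le_epsilon)
    fix e :: real assume "e > 0"
    have "(\<lambda>n. \<phi> (b n) x / b n + \<psi> (b n) y / b n) \<longlonglongrightarrow> \<phi>\<^sub>0 x + \<psi>\<^sub>0 y"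
      by (intro tendsto_add tendsto_uniform_limitI[OF assms(1)] tendsto_uniform_limitI[OF assms(2)]) auto
    then show "\<phi>\<^sub>0 x + \<psi>\<^sub>0 y \<le> - A (x, y) + e"
      by (rule tendsto_upperbound)
        (use eventually_feasible[OF \<open>e > 0\<close>] in \<open>auto elim: eventually_mono\<close>)
  qed
  with c0 show "(\<phi>\<^sub>0, \<psi>\<^sub>0) \<in> dual_feasible (\<lambda>z. - A z)"
    by (simp add: dual_feasible_def)
  have "(\<lambda>n. \<integral>x. \<phi> (b n) x / b n \<partial>\<mu>) \<longlonglongrightarrow> (\<integral>x. \<phi>\<^sub>0 x \<partial>\<mu>)"
    by (rule X.integral_uniform_limit[OF c(1) assms(1)])
  moreover have "(\<lambda>n. \<integral>y. \<psi> (b n) y / b n \<partial>\<nu>) \<longlonglongrightarrow> (\<integral>y. \<psi>\<^sub>0 y \<partial>\<nu>)"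
    by (rule Y.integral_uniform_limit[OF c(2) assms(2)])
  ultimately have "(\<lambda>n. (\<integral>x. \<phi> (b n) x / b n \<partial>\<mu>) + (\<integral>y. \<psi> (b n) y / b n \<partial>\<nu>))
      \<longlonglongrightarrow> (\<integral>x. \<phi>\<^sub>0 x \<partial>\<mu>) + (\<integral>y. \<psi>\<^sub>0 y \<partial>\<nu>)"
    by (rule tendsto_add)
  then show "transport_cost \<mu> \<nu> (\<lambda>z. - A z) = (\<integral>x. \<phi>\<^sub>0 x \<partial>\<mu>) + (\<integral>y. \<psi>\<^sub>0 y \<partial>\<nu>)"
    by (rule LIMSEQ_unique[OF dual_value_tendsto])
qed

theorem gibbs_plan_limit_optimal:
  assumes \<pi>: "\<pi> \<in> borel_probs"
    and conv: "weakstar_conv (\<lambda>n. gibbs_plan \<mu> \<nu> A (b n) (\<phi> (b n)) (\<psi> (b n))) \<pi>"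
  shows "\<pi> \<in> transference_plans \<mu> \<nu>"
    and "(\<integral>z. - A z \<partial>\<pi>) = transport_cost \<mu> \<nu> (\<lambda>z. - A z)"
proof -
  have lim: "(\<lambda>n. \<integral>z. f z \<partial>plan n) \<longlonglongrightarrow> (\<integral>z. f z \<partial>\<pi>)" if "continuous_on UNIV f" for f :: "'a \<times> 'b \<Rightarrow> real"
    using conv that by (simp add: weakstar_conv_def plan_def)
  show "\<pi> \<in> transference_plans \<mu> \<nu>"
  proof (rule transference_planI[OF \<pi>])
    fix f :: "'a \<Rightarrow> real" assume f: "continuous_on UNIV f"
    show "(\<integral>z. f (fst z) \<partial>\<pi>) = (\<integral>x. f x \<partial>\<mu>)"
      using lim[OF continuous_fst_comp[OF f]] by (simp add: integral_marginals[OF plan] f LIMSEQ_const_iff)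
  next
    fix f :: "'b \<Rightarrow> real" assume f: "continuous_on UNIV f"
    show "(\<integral>z. f (snd z) \<partial>\<pi>) = (\<integral>y. f y \<partial>\<nu>)"
      using lim[OF continuous_snd_comp[OF f]] by (simp add: integral_marginals[OF plan] f LIMSEQ_const_iff)
  qed
  have "(\<lambda>n. \<integral>z. - A z \<partial>plan n) \<longlonglongrightarrow> transport_cost \<mu> \<nu> (\<lambda>z. - A z)"
    by (rule tendsto_sandwich[OF _ _ tendsto_const dual_value_tendsto])
      (use cost_le energy_le in \<open>simp_all add: dual_value_def\<close>)
  then show "(\<integral>z. - A z \<partial>\<pi>) = transport_cost \<mu> \<nu> (\<lambda>z. - A z)"
    by (rule LIMSEQ_unique[OF lim[OF continuous_on_minus[OF continuous_A]]])
qed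

end

lemma normalizing_pair_shift:
  "normalizing_pair \<mu> \<nu> A \<beta> \<phi> \<psi> \<Longrightarrow> normalizing_pair \<mu> \<nu> A \<beta> (\<lambda>x. \<phi> x - d) (\<lambda>y. \<psi> y + d)"
  by (auto simp: normalizing_pair_def algebra_simps intro!: continuous_intros)

lemma normalizing_pair_oscillation:
  assumes "\<beta> > 0" "normalizing_pair \<mu> \<nu> A \<beta> \<phi> \<psi>" "\<And>z. \<bar>A z\<bar> \<le> K"
  shows "\<bar>\<phi> x - \<phi> x'\<bar> \<le> \<beta> * (2 * K)"
proof -
  have \<phi>: "\<phi> = x_transform \<beta> \<psi>" and \<psi>: "continuous_on UNIV \<psi>"
    using assms(2) unfolding normalizing_pair_iff by blast+
  have "\<bar>\<beta> * A (x, y) - \<beta> * A (x', y)\<bar> \<le> \<beta> * (2 * K)" for y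
  proof -
    have "\<bar>A (x, y) - A (x', y)\<bar> \<le> 2 * K"
      using assms(3)[of "(x, y)"] assms(3)[of "(x', y)"] by linarith
    from mult_left_mono[OF this, of \<beta>] assms(1) show ?thesis
      by (simp add: right_diff_distrib[symmetric] abs_mult)
  qed
  then show ?thesis
    unfolding \<phi> by (intro Y.soft_transform_modulus continuous_intros \<psi>)
qed

text \<open>
  The log-partition of \<open>0\<close> is \<open>0\<close>, so the nonexpansiveness of the functional in the supremum norm
  bounds the transform by the size of its argument.
\<close>

lemma normalizing_pair_bound:
  assumes "\<beta> > 0" and n: "normalizing_pair \<mu> \<nu> A \<beta> \<phi> \<psi>" and "\<And>z. \<bar>A z\<bar> \<le> K" and \<phi>_le: "\<And>x. \<bar>\<phi> x\<bar> \<le> \<beta> * C"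
  shows "\<bar>\<psi> y\<bar> \<le> \<beta> * (K + C)"
proof -
  have cont: "continuous_on UNIV \<phi>" and \<psi>: "\<psi> = y_transform \<beta> \<phi>"
    using n unfolding normalizing_pair_iff by blast+
  have "\<bar>log_partition \<mu> (\<lambda>x. \<beta> * A (x, y) + \<phi> x) - log_partition \<mu> (\<lambda>_. 0)\<bar> \<le> \<beta> * (K + C)"
  proof (intro X.log_partition_abs_diff_le continuous_intros cont)
    fix x
    have "\<bar>\<beta> * A (x, y)\<bar> \<le> \<beta> * K"
      using assms(1,3) by (simp add: abs_mult)
    then show "\<bar>\<beta> * A (x, y) + \<phi> x - 0\<bar> \<le> \<beta> * (K + C)"
      using \<phi>_le[of x] by (simp add: distrib_left)
  qed
  then show ?thesis by (simp add: \<psi> X.soft_transform_def log_partition_def)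
qed

theorem uniformly_bounded_choice:
  "\<exists>\<phi> \<psi>. (\<forall>\<beta>>0. normalizing_pair \<mu> \<nu> A \<beta> (\<phi> \<beta>) (\<psi> \<beta>)) \<and>
     uniformly_bounded_family {0<..} (\<lambda>\<beta> x. \<phi> \<beta> x / \<beta>) \<and>
     uniformly_bounded_family {0<..} (\<lambda>\<beta> y. \<psi> \<beta> y / \<beta>)"
proof -
  obtain K where K: "\<And>z. \<bar>A z\<bar> \<le> K"
    using P.continuous_bounded[OF continuous_A] by blast
  define x0 :: 'a where "x0 = undefined"
  have "\<exists>\<phi> \<psi>. normalizing_pair \<mu> \<nu> A \<beta> \<phi> \<psi> \<and> \<phi> x0 = 0" if \<beta>: "\<beta> > 0" for \<beta>
  proof -
    obtain \<phi> \<psi> where "normalizing_pair \<mu> \<nu> A \<beta> \<phi> \<psi>"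
      using normalizing_pair_exists[OF \<beta>] by blast
    from normalizing_pair_shift[OF this, of "\<phi> x0"] show ?thesis
      by (intro exI[of _ "\<lambda>x. \<phi> x - \<phi> x0"] exI[of _ "\<lambda>y. \<psi> y + \<phi> x0"]) simp
  qed
  then obtain \<phi> \<psi> where pair: "\<And>\<beta>. \<beta> > 0 \<Longrightarrow> normalizing_pair \<mu> \<nu> A \<beta> (\<phi> \<beta>) (\<psi> \<beta>)"
    and x0: "\<And>\<beta>. \<beta> > 0 \<Longrightarrow> \<phi> \<beta> x0 = 0"
    by metis
  have \<phi>_le: "\<bar>\<phi> \<beta> x\<bar> \<le> \<beta> * (2 * K)" if "\<beta> > 0" for \<beta> x
    using normalizing_pair_oscillation[OF that pair[OF that] K, of x x0] x0[OF that] by simp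
  have \<psi>_le: "\<bar>\<psi> \<beta> y\<bar> \<le> \<beta> * (K + 2 * K)" if "\<beta> > 0" for \<beta> y
    by (rule normalizing_pair_bound[OF that pair[OF that] K \<phi>_le[OF that]])
  show ?thesis
  proof (intro exI conjI allI impI)
    show "normalizing_pair \<mu> \<nu> A \<beta> (\<phi> \<beta>) (\<psi> \<beta>)" if "0 < \<beta>" for \<beta> using pair[OF that] .
    show "uniformly_bounded_family {0<..} (\<lambda>\<beta> x. \<phi> \<beta> x / \<beta>)"
      unfolding uniformly_bounded_family_def
      by (intro exI[of _ "2 * K"]) (use \<phi>_le in \<open>auto simp: pos_divide_le_eq mult.commute\<close>)
    show "uniformly_bounded_family {0<..} (\<lambda>\<beta> y. \<psi> \<beta> y / \<beta>)"
      unfolding uniformly_bounded_family_def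
      by (intro exI[of _ "K + 2 * K"]) (use \<psi>_le in \<open>auto simp: pos_divide_le_eq mult.commute\<close>)
  qed
qed

end

lemma equicontinuous_family_if_lipschitz:
  assumes "\<And>i. i \<in> I \<Longrightarrow> lipschitz_wrt dist L (F i)"
  shows "equicontinuous_family I F"
  unfolding equicontinuous_family_def
proof (intro allI impI)
  fix \<epsilon> :: real assume "\<epsilon> > 0"
  define \<delta> where "\<delta> = \<epsilon> / (\<bar>L\<bar> + 1)"
  have "\<bar>F i x - F i y\<bar> < \<epsilon>" if "i \<in> I" "dist x y < \<delta>" for i x y
  proof -
    have "\<bar>F i x - F i y\<bar> \<le> L * dist x y"
      using assms[OF that(1)] by (simp add: lipschitz_wrt_def)
    also have "\<dots> \<le> (\<bar>L\<bar> + 1) * dist x y" by (intro mult_right_mono) auto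
    also have "\<dots> < (\<bar>L\<bar> + 1) * \<delta>" using that(2) by (intro mult_strict_left_mono) auto
    also have "\<dots> = \<epsilon>" by (simp add: \<delta>_def)
    finally show ?thesis .
  qed
  moreover have "\<delta> > 0" using \<open>\<epsilon> > 0\<close> by (simp add: \<delta>_def)
  ultimately show "\<exists>\<delta>>0. \<forall>i\<in>I. \<forall>x y. dist x y < \<delta> \<longrightarrow> \<bar>F i x - F i y\<bar> < \<epsilon>" by blast
qed

lemma lipschitz_wrt_divide:
  assumes "\<beta> > 0" "lipschitz_wrt d (\<beta> * L) f"
  shows "lipschitz_wrt d L (\<lambda>x. f x / \<beta>)"
  using assms by (auto simp: lipschitz_wrt_def diff_divide_distrib[symmetric] zero_le_mult_iff
      pos_divide_le_eq mult_ac)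

lemma Lip_le:
  assumes "lipschitz_wrt d L f"
  shows "Lip d f \<le> L"
  unfolding Lip_def
  by (rule cInf_lower) (use assms in \<open>auto intro!: bdd_belowI[of _ 0] simp: lipschitz_wrt_def\<close>)

theorem theorem1p1:
  fixes \<mu> :: "'a::metric_space measure" and \<nu> :: "'b::metric_space measure"
    and c A :: "'a \<times> 'b \<Rightarrow> real"
  assumes compact_X: "compact (UNIV :: 'a set)" and compact_Y: "compact (UNIV :: 'b set)"
    and \<mu>: "\<mu> \<in> borel_probs" and \<nu>: "\<nu> \<in> borel_probs"
    and supp_\<mu>: "msupport \<mu> = UNIV" and supp_\<nu>: "msupport \<nu> = UNIV"
    and lip_c: "lipschitz_cont sum_dist c"
    and A: "A = (\<lambda>z. - c z)"
  shows
    "((\<forall>\<beta>>0. \<exists>\<phi> \<psi>. normalizing_pair \<mu> \<nu> A \<beta> \<phi> \<psi>) \<and>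
      (\<forall>\<beta>>0. \<forall>\<phi> \<psi> \<phi>' \<psi>'.
         normalizing_pair \<mu> \<nu> A \<beta> \<phi> \<psi> \<and> normalizing_pair \<mu> \<nu> A \<beta> \<phi>' \<psi>' \<longrightarrow>
         (\<exists>d. (\<forall>x. \<phi>' x = \<phi> x + d) \<and> (\<forall>y. \<psi>' y = \<psi> y - d))) \<and>
      (\<forall>\<beta>>0. \<forall>\<phi> \<psi>. normalizing_pair \<mu> \<nu> A \<beta> \<phi> \<psi> \<longrightarrow>
         lipschitz_cont dist \<phi> \<and> lipschitz_cont dist \<psi> \<and>
         Lip dist \<phi> \<le> \<beta> * Lip sum_dist A \<and> Lip dist \<psi> \<le> \<beta> * Lip sum_dist A))
     \<and>
     (\<forall>\<beta>>0. \<forall>\<phi> \<psi>. normalizing_pair \<mu> \<nu> A \<beta> \<phi> \<psi> \<longrightarrow>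
        gibbs_plan \<mu> \<nu> A \<beta> \<phi> \<psi> \<in> borel_probs \<and>
        gibbs_plan \<mu> \<nu> A \<beta> \<phi> \<psi> \<in> transference_plans \<mu> \<nu> \<and>
        pressure \<mu> \<nu> (\<lambda>z. \<beta> * A z) =
          ereal (\<integral>z. \<beta> * A z \<partial>gibbs_plan \<mu> \<nu> A \<beta> \<phi> \<psi>)
          + plan_entropy \<mu> \<nu> (gibbs_plan \<mu> \<nu> A \<beta> \<phi> \<psi>) \<and>
        pressure \<mu> \<nu> (\<lambda>z. \<beta> * A z) = ereal (- (\<integral>x. \<phi> x \<partial>\<mu>) - (\<integral>y. \<psi> y \<partial>\<nu>)))
     \<and>
     ((\<exists>\<phi> \<psi>. (\<forall>\<beta>>0. normalizing_pair \<mu> \<nu> A \<beta> (\<phi> \<beta>) (\<psi> \<beta>)) \<and>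
         uniformly_bounded_family {0<..} (\<lambda>\<beta> x. \<phi> \<beta> x / \<beta>) \<and>
         uniformly_bounded_family {0<..} (\<lambda>\<beta> y. \<psi> \<beta> y / \<beta>)) \<and>
      (\<forall>\<phi> \<psi>. (\<forall>\<beta>>0. normalizing_pair \<mu> \<nu> A \<beta> (\<phi> \<beta>) (\<psi> \<beta>)) \<longrightarrow>
         equicontinuous_family {0<..} (\<lambda>\<beta> x. \<phi> \<beta> x / \<beta>) \<and>
         equicontinuous_family {0<..} (\<lambda>\<beta> y. \<psi> \<beta> y / \<beta>) \<and>
         (\<forall>b \<phi>\<^sub>0 \<psi>\<^sub>0.
            (\<forall>n::nat. b n > 0) \<and> filterlim b at_top sequentially \<and>
            uniform_limit UNIV (\<lambda>n x. \<phi> (b n) x / b n) \<phi>\<^sub>0 sequentially \<and>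
            uniform_limit UNIV (\<lambda>n y. \<psi> (b n) y / b n) \<psi>\<^sub>0 sequentially \<longrightarrow>
            (\<phi>\<^sub>0, \<psi>\<^sub>0) \<in> dual_feasible c \<and>
            transport_cost \<mu> \<nu> c = (\<integral>x. \<phi>\<^sub>0 x \<partial>\<mu>) + (\<integral>y. \<psi>\<^sub>0 y \<partial>\<nu>)) \<and>
         (\<forall>b \<pi>.
            (\<forall>n::nat. b n > 0) \<and> filterlim b at_top sequentially \<and> \<pi> \<in> borel_probs \<and>
            weakstar_conv (\<lambda>n. gibbs_plan \<mu> \<nu> A (b n) (\<phi> (b n)) (\<psi> (b n))) \<pi> \<longrightarrow>
            \<pi> \<in> transference_plans \<mu> \<nu> \<and> (\<integral>z. c z \<partial>\<pi>) = transport_cost \<mu> \<nu> c)))"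
proof -
  have c: "c = (\<lambda>z. - A z)" using A by simp
  define lips where "lips = {L. lipschitz_wrt sum_dist L A}"
  have lips_ne: "lips \<noteq> {}"
    using lip_c by (auto simp: lips_def A lipschitz_cont_def lipschitz_wrt_def abs_minus_commute)
  have transport: "lipschitz_transport \<mu> \<nu> A L" if "L \<in> lips" for L
    using that by unfold_locales (auto simp: compact_X compact_Y \<mu> \<nu> lips_def)
  obtain L where "L \<in> lips" using lips_ne by blast
  interpret lipschitz_transport \<mu> \<nu> A L by (rule transport) fact
  \<comment> \<open>The Lipschitz estimates hold for every Lipschitz constant of \<open>A\<close>, hence for their infimum.\<close>
  have Lip_bound: "Lip dist \<phi> \<le> \<beta> * Lip sum_dist A \<and> Lip dist \<psi> \<le> \<beta> * Lip sum_dist A"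
    if "\<beta> > 0" "normalizing_pair \<mu> \<nu> A \<beta> \<phi> \<psi>" for \<beta> \<phi> \<psi>
  proof -
    have "Lip dist \<phi> \<le> \<beta> * L'" "Lip dist \<psi> \<le> \<beta> * L'" if "L' \<in> lips" for L'
    proof -
      interpret L': lipschitz_transport \<mu> \<nu> A L' by (rule transport) fact
      show "Lip dist \<phi> \<le> \<beta> * L'" "Lip dist \<psi> \<le> \<beta> * L'"
        by (rule Lip_le, rule L'.normalizing_pair_lipschitz, fact, fact)+
    qed
    then have "Lip dist \<phi> / \<beta> \<le> L'" "Lip dist \<psi> / \<beta> \<le> L'" if "L' \<in> lips" for L'
      using that \<open>\<beta> > 0\<close> by (simp_all add: pos_divide_le_eq mult.commute)
    then have "Lip dist \<phi> / \<beta> \<le> Inf lips" "Lip dist \<psi> / \<beta> \<le> Inf lips"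
      using lips_ne by (auto intro!: cInf_greatest)
    then show ?thesis
      unfolding Lip_def[of sum_dist] lips_def[symmetric] using \<open>\<beta> > 0\<close>
      by (simp add: pos_divide_le_eq mult.commute)
  qed
  have equicont: "equicontinuous_family {0<..} (\<lambda>\<beta> x. \<phi> \<beta> x / \<beta>) \<and>
      equicontinuous_family {0<..} (\<lambda>\<beta> y. \<psi> \<beta> y / \<beta>)"
    if "\<forall>\<beta>>0. normalizing_pair \<mu> \<nu> A \<beta> (\<phi> \<beta>) (\<psi> \<beta>)" for \<phi> \<psi>
    using that normalizing_pair_lipschitz
    by (auto intro!: equicontinuous_family_if_lipschitz[where L = L] lipschitz_wrt_divide)
  show ?thesis
  proof (intro conjI allI impI; (elim conjE)?)
    fix \<beta> :: real assume "0 < \<beta>"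
    then show "\<exists>\<phi> \<psi>. normalizing_pair \<mu> \<nu> A \<beta> \<phi> \<psi>" by (rule normalizing_pair_exists)
  next
    fix \<beta> :: real and \<phi> \<psi> \<phi>' \<psi>'
    assume "0 < \<beta>" "normalizing_pair \<mu> \<nu> A \<beta> \<phi> \<psi>" "normalizing_pair \<mu> \<nu> A \<beta> \<phi>' \<psi>'"
    then show "\<exists>d. (\<forall>x. \<phi>' x = \<phi> x + d) \<and> (\<forall>y. \<psi>' y = \<psi> y - d)"
      by (rule normalizing_pair_unique)
  next
    fix \<beta> :: real and \<phi> \<psi>
    assume pair: "0 < \<beta>" "normalizing_pair \<mu> \<nu> A \<beta> \<phi> \<psi>"
    show "lipschitz_cont dist \<phi>" "lipschitz_cont dist \<psi>"
      using normalizing_pair_lipschitz[OF pair] by (auto simp: lipschitz_cont_def)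
    show "Lip dist \<phi> \<le> \<beta> * Lip sum_dist A" "Lip dist \<psi> \<le> \<beta> * Lip sum_dist A"
      using Lip_bound[OF pair] by auto
    show "gibbs_plan \<mu> \<nu> A \<beta> \<phi> \<psi> \<in> borel_probs"
      "gibbs_plan \<mu> \<nu> A \<beta> \<phi> \<psi> \<in> transference_plans \<mu> \<nu>"
      using gibbs_plan_borel_prob[OF pair(2)] gibbs_plan_transference_plan[OF pair(2)] by auto
    show "pressure \<mu> \<nu> (\<lambda>z. \<beta> * A z) = ereal (\<integral>z. \<beta> * A z \<partial>gibbs_plan \<mu> \<nu> A \<beta> \<phi> \<psi>)
        + plan_entropy \<mu> \<nu> (gibbs_plan \<mu> \<nu> A \<beta> \<phi> \<psi>)"
      "pressure \<mu> \<nu> (\<lambda>z. \<beta> * A z) = ereal (- (\<integral>x. \<phi> x \<partial>\<mu>) - (\<integral>y. \<psi> y \<partial>\<nu>))"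
      using pressure_eq[OF pair(2)] by auto
  next
    show "\<exists>\<phi> \<psi>. (\<forall>\<beta>>0. normalizing_pair \<mu> \<nu> A \<beta> (\<phi> \<beta>) (\<psi> \<beta>)) \<and>
        uniformly_bounded_family {0<..} (\<lambda>\<beta> x. \<phi> \<beta> x / \<beta>) \<and>
        uniformly_bounded_family {0<..} (\<lambda>\<beta> y. \<psi> \<beta> y / \<beta>)"
      by (rule uniformly_bounded_choice)
  next
    fix \<phi> \<psi>
    assume pairs: "\<forall>\<beta>>0. normalizing_pair \<mu> \<nu> A \<beta> (\<phi> \<beta>) (\<psi> \<beta>)"
    then show "equicontinuous_family {0<..} (\<lambda>\<beta> x. \<phi> \<beta> x / \<beta>)"
      "equicontinuous_family {0<..} (\<lambda>\<beta> y. \<psi> \<beta> y / \<beta>)"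
      using equicont by auto
    fix b :: "nat \<Rightarrow> real"
    assume b: "\<forall>n. 0 < b n" "filterlim b at_top sequentially"
    {
      fix \<phi>\<^sub>0 \<psi>\<^sub>0
      assume "uniform_limit UNIV (\<lambda>n x. \<phi> (b n) x / b n) \<phi>\<^sub>0 sequentially"
        "uniform_limit UNIV (\<lambda>n y. \<psi> (b n) y / b n) \<psi>\<^sub>0 sequentially"
      then show "(\<phi>\<^sub>0, \<psi>\<^sub>0) \<in> dual_feasible c"
        "transport_cost \<mu> \<nu> c = (\<integral>x. \<phi>\<^sub>0 x \<partial>\<mu>) + (\<integral>y. \<psi>\<^sub>0 y \<partial>\<nu>)"
        unfolding c using potential_limit_solves_dual[of \<phi> \<psi> b] supp_\<mu> pairs b by auto
    }
    {
      fix \<pi>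
      assume "\<pi> \<in> borel_probs"
        "weakstar_conv (\<lambda>n. gibbs_plan \<mu> \<nu> A (b n) (\<phi> (b n)) (\<psi> (b n))) \<pi>"
      then show "\<pi> \<in> transference_plans \<mu> \<nu>" "(\<integral>z. c z \<partial>\<pi>) = transport_cost \<mu> \<nu> c"
        unfolding c using gibbs_plan_limit_optimal[of \<phi> \<psi> b] supp_\<mu> pairs b by auto
    }
  qed
qed

end
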